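(* There exist an absolute constant $K>0$ and an algorithm with the following properties. Its input consists of positive integers $n,r$, vectors $\mathbf{t},\mathbf{s}\in\mathbb{C}^n$ such that $t_i\neq s_j$ for all $i,j\in\{1,\dots,n\}$, matrices $G,H\in\mathbb{C}^{n\times r}$, and a vector $\mathbf{b}\in\mathbb{C}^n$. No further assumption is made on the knots; in particular $\mathbf{s}$ and $\mathbf{t}$ may have repeated entries. Let $C\in\mathbb{C}^{n\times n}$ be the Cauchy-like matrix with entries $$C_{ij}=\frac{(GH^* )_{ij}}{t_i-s_j},\qquad i,j=1,\dots,n.$$ If $C$ is nonsingular, then the algorithm computes (in exact arithmetic) the solution $\mathbf{x}=C^{-1}\mathbf{b}$ of the linear system $C\mathbf{x}=\mathbf{b}$, using at most $K\,r\,n^2$ arithmetic operations and at most $K\,r\,n$ memory locations.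
   Context: The asterisk denotes the conjugate transpose. The matrix $C$ defined in the claim is the unique matrix satisfying the displacement equation $D_{\mathbf{t}}C-CD_{\mathbf{s}}=GH^*$, where $D_{\mathbf{v}}=\operatorname{diag}(v_1,\dots,v_n)$; the entries of $\mathbf{t}$ and $\mathbf{s}$ are called the knots, $G,H$ the generators, and $r$ the displacement rank. A Cauchy-like matrix is called reconstructable if $t_i\neq s_j$ for all $i,j$. Computational model: algorithms operate in exact arithmetic on complex numbers. Each memory location stores one complex number (or one integer index between $0$ and $O(n+r)$). An arithmetic operation is one of: addition, subtraction, multiplication, or division of complex numbers, complex conjugation, an equality test between two complex numbers, or a comparison of the absolute values of two complex numbers. The matrix $C$ is not given explicitly; only the data $\mathbf{t},\mathbf{s},G,H,\mathbf{b}$ are given. *)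

theory Defs
  imports "Jordan_Normal_Form.Schur_Decomposition"
begin

section \<open>Cauchy-like matrices\<close>

text \<open>Vectors and matrices are indexed from 0.\<close>

definition cauchy_like ::
  "nat \<Rightarrow> complex vec \<Rightarrow> complex vec \<Rightarrow> complex mat \<Rightarrow> complex mat \<Rightarrow> complex mat" where
  "cauchy_like n t s G H =
     mat n n (\<lambda>(i, j). (G * mat_adjoint H) $$ (i, j) / (t $ i - s $ j))"


section \<open>A random access machine over the complex numbers\<close>

text \<open>
  The memory is organised in arrays named by natural numbers; the cell \<open>(a, i, j)\<close> is the entry
  in row \<open>i\<close> and column \<open>j\<close> of array \<open>a\<close>, and scalars are entries at \<open>(0, 0)\<close>. There are two
  separate banks, one for complex numbers and one for natural numbers (indices). Two-dimensional
  addressing makes \<open>O(r n)\<close> cells reachable although indices have size \<open>O(n + r)\<close> only.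

  Programs are finite syntax, so a program names only finitely many arrays and contains
  only finitely many constants, and the same program serves all problem sizes.
\<close>

type_synonym cell = "nat \<times> nat \<times> nat"

datatype loc = Num cell | Idx cell

text \<open>
  The last three fields only do the accounting; no program can inspect them: the number of
  arithmetic operations performed, the memory locations occupied by the input or accessed (read
  or written), and the largest index stored.
\<close>

record state =
  num :: "cell \<Rightarrow> complex"
  idx :: "cell \<Rightarrow> nat"
  ops :: nat
  used :: "loc set"
  peak :: nat

text \<open>The operand \<open>Var x\<close> is the scalar index variable stored in the index cell \<open>(x, 0, 0)\<close>.\<close>

datatype iarg = Lit nat | Var nat

datatype ref = Ref nat iarg iarg

datatype arith = Plus | Minus | Times | Divide

datatype test =
    NumEq ref ref
  | NumAbsLe ref ref
  | IdxEq iarg iarg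
  | IdxLess iarg iarg

datatype instr =
    NumConst ref int
  | NumCopy ref ref
  | NumArith arith ref ref ref
  | NumConj ref ref
  | IdxSet ref iarg
  | IdxCopy ref ref
  | IdxPlus ref iarg iarg
  | IdxMinus ref iarg iarg

datatype com =
    Skip
  | Instr instr
  | Seq com com
  | Cond test com com
  | While test com

fun ival :: "state \<Rightarrow> iarg \<Rightarrow> nat" where
  "ival \<sigma> (Lit c) = c"
| "ival \<sigma> (Var x) = idx \<sigma> (x, 0, 0)"

fun ilocs :: "iarg \<Rightarrow> loc set" where
  "ilocs (Lit c) = {}"
| "ilocs (Var x) = {Idx (x, 0, 0)}"

fun addr :: "state \<Rightarrow> ref \<Rightarrow> cell" where
  "addr \<sigma> (Ref a u v) = (a, ival \<sigma> u, ival \<sigma> v)"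

fun alocs :: "ref \<Rightarrow> loc set" where
  "alocs (Ref a u v) = ilocs u \<union> ilocs v"

definition nval :: "state \<Rightarrow> ref \<Rightarrow> complex" where
  "nval \<sigma> p = num \<sigma> (addr \<sigma> p)"

definition nlocs :: "state \<Rightarrow> ref \<Rightarrow> loc set" where
  "nlocs \<sigma> p = insert (Num (addr \<sigma> p)) (alocs p)"

definition xlocs :: "state \<Rightarrow> ref \<Rightarrow> loc set" where
  "xlocs \<sigma> p = insert (Idx (addr \<sigma> p)) (alocs p)"

fun arith_val :: "arith \<Rightarrow> complex \<Rightarrow> complex \<Rightarrow> complex" where
  "arith_val Plus x y = x + y"
| "arith_val Minus x y = x - y"
| "arith_val Times x y = x * y"
| "arith_val Divide x y = x / y"

definition write_num :: "state \<Rightarrow> ref \<Rightarrow> complex \<Rightarrow> nat \<Rightarrow> loc set \<Rightarrow> state" where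
  "write_num \<sigma> d v k L = \<sigma>\<lparr>num := (num \<sigma>)(addr \<sigma> d := v),
     ops := ops \<sigma> + k, used := used \<sigma> \<union> nlocs \<sigma> d \<union> L\<rparr>"

definition write_idx :: "state \<Rightarrow> ref \<Rightarrow> nat \<Rightarrow> loc set \<Rightarrow> state" where
  "write_idx \<sigma> d v L = \<sigma>\<lparr>idx := (idx \<sigma>)(addr \<sigma> d := v),
     used := used \<sigma> \<union> xlocs \<sigma> d \<union> L, peak := max (peak \<sigma>) v\<rparr>"

text \<open>
  Operations on complex numbers cost 1. Copying, loading an integer constant and manipulating
  indices are not arithmetic operations. \<open>IdxMinus\<close> is truncated subtraction.
\<close>

fun step :: "instr \<Rightarrow> state \<Rightarrow> state" where
  "step (NumConst d c) \<sigma> = write_num \<sigma> d (of_int c) 0 {}"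
| "step (NumCopy d p) \<sigma> = write_num \<sigma> d (nval \<sigma> p) 0 (nlocs \<sigma> p)"
| "step (NumArith f d p q) \<sigma> =
     write_num \<sigma> d (arith_val f (nval \<sigma> p) (nval \<sigma> q)) 1 (nlocs \<sigma> p \<union> nlocs \<sigma> q)"
| "step (NumConj d p) \<sigma> = write_num \<sigma> d (cnj (nval \<sigma> p)) 1 (nlocs \<sigma> p)"
| "step (IdxSet d u) \<sigma> = write_idx \<sigma> d (ival \<sigma> u) (ilocs u)"
| "step (IdxCopy d p) \<sigma> = write_idx \<sigma> d (idx \<sigma> (addr \<sigma> p)) (xlocs \<sigma> p)"
| "step (IdxPlus d u v) \<sigma> = write_idx \<sigma> d (ival \<sigma> u + ival \<sigma> v) (ilocs u \<union> ilocs v)"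
| "step (IdxMinus d u v) \<sigma> = write_idx \<sigma> d (ival \<sigma> u - ival \<sigma> v) (ilocs u \<union> ilocs v)"

text \<open>Division by zero has no execution.\<close>

fun enabled :: "instr \<Rightarrow> state \<Rightarrow> bool" where
  "enabled (NumArith Divide d p q) \<sigma> \<longleftrightarrow> nval \<sigma> q \<noteq> 0"
| "enabled _ \<sigma> \<longleftrightarrow> True"

fun holds :: "test \<Rightarrow> state \<Rightarrow> bool" where
  "holds (NumEq p q) \<sigma> \<longleftrightarrow> nval \<sigma> p = nval \<sigma> q"
| "holds (NumAbsLe p q) \<sigma> \<longleftrightarrow> cmod (nval \<sigma> p) \<le> cmod (nval \<sigma> q)"
| "holds (IdxEq u v) \<sigma> \<longleftrightarrow> ival \<sigma> u = ival \<sigma> v"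
| "holds (IdxLess u v) \<sigma> \<longleftrightarrow> ival \<sigma> u < ival \<sigma> v"

fun charge :: "test \<Rightarrow> state \<Rightarrow> state" where
  "charge (NumEq p q) \<sigma> = \<sigma>\<lparr>ops := ops \<sigma> + 1, used := used \<sigma> \<union> nlocs \<sigma> p \<union> nlocs \<sigma> q\<rparr>"
| "charge (NumAbsLe p q) \<sigma> = \<sigma>\<lparr>ops := ops \<sigma> + 1, used := used \<sigma> \<union> nlocs \<sigma> p \<union> nlocs \<sigma> q\<rparr>"
| "charge (IdxEq u v) \<sigma> = \<sigma>\<lparr>used := used \<sigma> \<union> ilocs u \<union> ilocs v\<rparr>"
| "charge (IdxLess u v) \<sigma> = \<sigma>\<lparr>used := used \<sigma> \<union> ilocs u \<union> ilocs v\<rparr>"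

text \<open>\<open>exec c \<sigma> \<tau>\<close>: started in \<open>\<sigma>\<close>, the program \<open>c\<close> terminates in \<open>\<tau>\<close>.\<close>

inductive exec :: "com \<Rightarrow> state \<Rightarrow> state \<Rightarrow> bool" where
  Skip: "exec Skip \<sigma> \<sigma>"
| Instr: "enabled i \<sigma> \<Longrightarrow> exec (Instr i) \<sigma> (step i \<sigma>)"
| Seq: "exec c \<sigma> \<rho> \<Longrightarrow> exec d \<rho> \<tau> \<Longrightarrow> exec (Seq c d) \<sigma> \<tau>"
| IfTrue: "holds b \<sigma> \<Longrightarrow> exec c (charge b \<sigma>) \<tau> \<Longrightarrow> exec (Cond b c d) \<sigma> \<tau>"
| IfFalse: "\<not> holds b \<sigma> \<Longrightarrow> exec d (charge b \<sigma>) \<tau> \<Longrightarrow> exec (Cond b c d) \<sigma> \<tau>"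
| WhileFalse: "\<not> holds b \<sigma> \<Longrightarrow> exec (While b c) \<sigma> (charge b \<sigma>)"
| WhileTrue: "holds b \<sigma> \<Longrightarrow> exec c (charge b \<sigma>) \<rho> \<Longrightarrow> exec (While b c) \<rho> \<tau> \<Longrightarrow>
    exec (While b c) \<sigma> \<tau>"

inductive_cases SkipE: "exec Skip \<sigma> \<tau>"
  and InstrE: "exec (Instr i) \<sigma> \<tau>"
  and SeqE: "exec (Seq c d) \<sigma> \<tau>"
  and CondE: "exec (Cond b c d) \<sigma> \<tau>"
  and WhileE: "exec (While b c) \<sigma> \<tau>"

text \<open>The final state is unique, so its existence amounts to total correctness.\<close>

lemma exec_deterministic: "exec c \<sigma> \<tau> \<Longrightarrow> exec c \<sigma> \<tau>' \<Longrightarrow> \<tau>' = \<tau>"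
proof (induction arbitrary: \<tau>' rule: exec.induct)
  case (Skip \<sigma>) then show ?case by (blast elim: SkipE)
next
  case (Instr i \<sigma>) from Instr.prems show ?case by (rule InstrE)
next
  case (Seq c \<sigma> \<rho> d \<tau>) from Seq.prems show ?case by (rule SeqE) (use Seq.IH in blast)
next
  case (IfTrue b \<sigma> c \<tau> d) from IfTrue.prems show ?case by (rule CondE) (use IfTrue in blast)+
next
  case (IfFalse b \<sigma> d \<tau> c) from IfFalse.prems show ?case by (rule CondE) (use IfFalse in blast)+
next
  case (WhileFalse b \<sigma> c)
  from WhileFalse.prems show ?case by (rule WhileE) (use WhileFalse in blast)+
next
  case (WhileTrue b \<sigma> c \<rho> \<tau>)
  from WhileTrue.prems show ?case by (rule WhileE) (use WhileTrue in blast)+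
qed


section \<open>Input and output\<close>

definition input_locs :: "nat \<Rightarrow> nat \<Rightarrow> loc set" where
  "input_locs n r =
     {Idx (0, 0, 0), Idx (1, 0, 0)}
     \<union> {Num (a, i, 0) | a i. a \<in> {0, 1, 4} \<and> i < n}
     \<union> {Num (a, i, k) | a i k. a \<in> {2, 3} \<and> i < n \<and> k < r}"

text \<open>
  The contents of all cells outside \<open>input_locs n r\<close> are left arbitrary, so a correct program
  cannot rely on memory it has not initialised.
\<close>

definition initial ::
  "nat \<Rightarrow> nat \<Rightarrow> complex vec \<Rightarrow> complex vec \<Rightarrow> complex mat \<Rightarrow> complex mat \<Rightarrow> complex vec \<Rightarrow>
    state \<Rightarrow> bool" where
  "initial n r t s G H b \<sigma> \<longleftrightarrow>
     idx \<sigma> (0, 0, 0) = n \<and> idx \<sigma> (1, 0, 0) = r \<and>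
     (\<forall>i<n. num \<sigma> (0, i, 0) = t $ i \<and> num \<sigma> (1, i, 0) = s $ i \<and> num \<sigma> (4, i, 0) = b $ i) \<and>
     (\<forall>i<n. \<forall>k<r. num \<sigma> (2, i, k) = G $$ (i, k) \<and> num \<sigma> (3, i, k) = H $$ (i, k)) \<and>
     ops \<sigma> = 0 \<and> used \<sigma> = input_locs n r \<and> peak \<sigma> = max n r"

definition result :: "nat \<Rightarrow> state \<Rightarrow> complex vec" where
  "result n \<tau> = vec n (\<lambda>i. num \<tau> (5, i, 0))"

end

theory Submission
  imports Defs
begin

text \<open>
  Gaussian elimination with row exchanges acts on the generators: with multipliers
  \<open>l = C_ik / C_kk\<close> and \<open>u = C_kj / C_kk\<close>, the Schur complement is Cauchy-like with left rows
  \<open>g_i - l g_k\<close> and right rows \<open>h_j - u h_k\<close>, so one step costs \<open>O(r n)\<close> without forming the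
  matrix. Storing the upper triangular factor \<open>U\<close> for the back substitution would take \<open>n^2\<close>
  cells. Instead, the backward phase undoes the updates of the \<open>h_j\<close>, recovering \<open>U_kj\<close> on the way
  from \<open>(s_k - s_j) U_kj = g_k \<cdot> h_j\<close>, where \<open>h_j\<close> is the row after step \<open>k\<close>. Only the \<open>U_kj\<close>
  with \<open>s_k = s_j\<close> cannot be recovered and are stored. Columns of \<open>C\<close> with the same knot are
  images of rows of \<open>H\<close> under one linear map, so in a nonsingular \<open>C\<close> each column knot has
  multiplicity at most \<open>r\<close>, and at most \<open>r n\<close> entries are stored.
\<close>

section \<open>Reasoning about programs\<close>

type_synonym mem = "cell \<Rightarrow> complex"
type_synonym env = "nat \<Rightarrow> nat"

text \<open>\<open>Var\<close> operands read only index cells \<open>(a, 0, 0)\<close>, so an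
  environment and the complex memory determine every address; the accounting fields of
  \<open>state\<close> stay out of the correctness argument.\<close>

fun iv :: "env \<Rightarrow> iarg \<Rightarrow> nat" where
  "iv e (Lit c) = c"
| "iv e (Var a) = e a"

fun ad :: "env \<Rightarrow> ref \<Rightarrow> cell" where
  "ad e (Ref a u v) = (a, iv e u, iv e v)"

fun nstep :: "instr \<Rightarrow> env \<Rightarrow> mem \<Rightarrow> mem" where
  "nstep (NumConst d c) e m = m(ad e d := of_int c)"
| "nstep (NumCopy d p) e m = m(ad e d := m (ad e p))"
| "nstep (NumArith f d p q) e m = m(ad e d := arith_val f (m (ad e p)) (m (ad e q)))"
| "nstep (NumConj d p) e m = m(ad e d := cnj (m (ad e p)))"
| "nstep _ e m = m"

fun ncost :: "instr \<Rightarrow> nat" where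
  "ncost (NumArith f d p q) = 1"
| "ncost (NumConj d p) = 1"
| "ncost _ = 0"

abbreviation scalar :: "nat \<Rightarrow> ref" where
  "scalar a \<equiv> Ref a (Lit 0) (Lit 0)"

text \<open>The counter starts at a sum so that a loop over the indices above \<open>k\<close> is
  entered with one instruction. Loop control only touches index variables and thus costs no
  arithmetic operations.\<close>

definition For :: "nat \<Rightarrow> iarg \<Rightarrow> iarg \<Rightarrow> iarg \<Rightarrow> com \<Rightarrow> com" where
  "For v a b h c = Seq (Instr (IdxPlus (scalar v) a b))
     (While (IdxLess (Var v) h) (Seq c (Instr (IdxPlus (scalar v) (Var v) (Lit 1)))))"

fun iok :: "iarg \<Rightarrow> bool" where
  "iok (Lit c) \<longleftrightarrow> True"
| "iok (Var a) \<longleftrightarrow> a < 6"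

lemma ival_iv: "(\<And>a. idx \<sigma> (a, 0, 0) = e a) \<Longrightarrow> ival \<sigma> u = iv e u"
  by (cases u) auto

lemma addr_ad: "(\<And>a. idx \<sigma> (a, 0, 0) = e a) \<Longrightarrow> addr \<sigma> p = ad e p"
  by (cases p) (auto simp: ival_iv)

text \<open>Space is bounded by a set of cells fixed in advance rather than by counting accesses:
  every access must fall into \<open>L\<close>, so the running time does not enter the space
  bound.\<close>

locale resources =
  fixes ok :: "cell \<Rightarrow> bool" and bound :: nat
begin

definition L :: "loc set" where
  "L = Num ` Collect ok \<union> (\<lambda>a. Idx (a, 0, 0)) ` {..<6}"

fun rok :: "env \<Rightarrow> ref \<Rightarrow> bool" where
  "rok e (Ref a u v) \<longleftrightarrow> iok u \<and> iok v \<and> ok (a, iv e u, iv e v)"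

text \<open>Index instructions are rejected here, which makes the catch-all clause of
  \<open>nstep\<close> harmless. They enter only through the counters of \<open>For\<close> and
  through \<open>runs_Seq_IdxMinus\<close>.\<close>

fun nok :: "instr \<Rightarrow> env \<Rightarrow> mem \<Rightarrow> bool" where
  "nok (NumConst d c) e m \<longleftrightarrow> rok e d"
| "nok (NumCopy d p) e m \<longleftrightarrow> rok e d \<and> rok e p"
| "nok (NumArith f d p q) e m \<longleftrightarrow>
     rok e d \<and> rok e p \<and> rok e q \<and> (f = Divide \<longrightarrow> m (ad e q) \<noteq> 0)"
| "nok (NumConj d p) e m \<longleftrightarrow> rok e d \<and> rok e p"
| "nok _ e m \<longleftrightarrow> False"

text \<open>
  In \<open>runs W k c m e Q\<close> the memory is split into complex cells \<open>m\<close> and scalar index variables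
  \<open>e\<close>; \<open>k\<close> bounds the arithmetic operations and \<open>W\<close> contains all index variables that may change.
\<close>

definition runs ::
  "nat set \<Rightarrow> nat \<Rightarrow> com \<Rightarrow> mem \<Rightarrow> env \<Rightarrow> (mem \<Rightarrow> bool) \<Rightarrow> bool" where
  "runs W k c m e Q \<longleftrightarrow> (\<forall>\<sigma>::state. num \<sigma> = m \<longrightarrow> (\<forall>a. idx \<sigma> (a, 0, 0) = e a) \<longrightarrow>
     (\<exists>\<tau>. exec c \<sigma> \<tau> \<and> ops \<tau> \<le> ops \<sigma> + k \<and> used \<tau> \<subseteq> used \<sigma> \<union> L \<and>
       peak \<tau> \<le> max (peak \<sigma>) bound \<and> Q (num \<tau>) \<and>
       (\<forall>a. a \<notin> W \<longrightarrow> idx \<tau> (a, 0, 0) = e a)))"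

section \<open>Rules for total correctness with bounds on operations, cells and indices\<close>

lemma runs_mono:
  assumes "runs W k c m e Q" "W \<subseteq> W'" "k \<le> k'" "\<And>m'. Q m' \<Longrightarrow> Q' m'"
  shows "runs W' k' c m e Q'"
  unfolding runs_def
proof (intro allI impI)
  fix \<sigma> :: state assume "num \<sigma> = m" "\<forall>a. idx \<sigma> (a, 0, 0) = e a"
  with assms(1) obtain \<tau> where "exec c \<sigma> \<tau>" "ops \<tau> \<le> ops \<sigma> + k" "used \<tau> \<subseteq> used \<sigma> \<union> L"
    "peak \<tau> \<le> max (peak \<sigma>) bound" "Q (num \<tau>)" "\<forall>a. a \<notin> W \<longrightarrow> idx \<tau> (a, 0, 0) = e a"
    unfolding runs_def by metis
  with assms(2-4) show "\<exists>\<tau>. exec c \<sigma> \<tau> \<and> ops \<tau> \<le> ops \<sigma> + k' \<and> used \<tau> \<subseteq> used \<sigma> \<union> L \<and>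
       peak \<tau> \<le> max (peak \<sigma>) bound \<and> Q' (num \<tau>) \<and>
       (\<forall>a. a \<notin> W' \<longrightarrow> idx \<tau> (a, 0, 0) = e a)"
    by (intro exI[of _ \<tau>]) (auto dest: order_trans)
qed

lemma runs_Skip: "Q m \<Longrightarrow> runs W k Skip m e Q"
  unfolding runs_def by (auto intro!: exI exec.Skip)

lemma ilocs_L: "iok u \<Longrightarrow> ilocs u \<subseteq> L"
  by (cases u) (auto simp: L_def)

lemma alocs_L: "rok e p \<Longrightarrow> alocs p \<subseteq> L"
  using ilocs_L by (cases p) auto

lemma nlocs_L:
  assumes "\<And>a. idx \<sigma> (a, 0, 0) = e a" "rok e p"
  shows "nlocs \<sigma> p \<subseteq> L"
  using alocs_L[OF assms(2)] assms
  by (cases p) (auto simp: nlocs_def L_def ival_iv[of \<sigma> e])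

lemma runs_Instr:
  assumes "nok i e m" "ncost i \<le> k" "Q (nstep i e m)"
  shows "runs W k (Instr i) m e Q"
  unfolding runs_def
proof (intro allI impI)
  fix \<sigma> :: state assume m: "num \<sigma> = m" and e: "\<forall>a. idx \<sigma> (a, 0, 0) = e a"
  note [simp] = addr_ad[of \<sigma> e, OF e[rule_format]]
  note n = nlocs_L[of \<sigma> e, OF e[rule_format]]
  have en: "enabled i \<sigma>"
    using assms(1) m by (cases "(i, \<sigma>)" rule: enabled.cases) (auto simp: nval_def)
  have "ops (step i \<sigma>) \<le> ops \<sigma> + k" "used (step i \<sigma>) \<subseteq> used \<sigma> \<union> L"
    "peak (step i \<sigma>) \<le> max (peak \<sigma>) bound" "num (step i \<sigma>) = nstep i e m"
    "idx (step i \<sigma>) = idx \<sigma>"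
    using assms(1,2) m n by (cases i; auto simp: write_num_def nval_def)+
  with exec.Instr[OF en] assms(3) e
  show "\<exists>\<tau>. exec (Instr i) \<sigma> \<tau> \<and> ops \<tau> \<le> ops \<sigma> + k \<and> used \<tau> \<subseteq> used \<sigma> \<union> L \<and>
       peak \<tau> \<le> max (peak \<sigma>) bound \<and> Q (num \<tau>) \<and>
       (\<forall>a. a \<notin> W \<longrightarrow> idx \<tau> (a, 0, 0) = e a)"
    by auto
qed

lemma runs_Seq:
  assumes c: "runs W k c m e P"
    and d: "\<And>m' e'. P m' \<Longrightarrow> (\<And>a. a \<notin> W \<Longrightarrow> e' a = e a) \<Longrightarrow> runs W k' d m' e' Q"
    and k: "k + k' \<le> K"
  shows "runs W K (Seq c d) m e Q"
  unfolding runs_def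
proof (intro allI impI)
  fix \<sigma> :: state assume "num \<sigma> = m" and "\<forall>a. idx \<sigma> (a, 0, 0) = e a"
  with c obtain \<rho> where \<rho>: "exec c \<sigma> \<rho>" "ops \<rho> \<le> ops \<sigma> + k" "used \<rho> \<subseteq> used \<sigma> \<union> L"
    "peak \<rho> \<le> max (peak \<sigma>) bound" "P (num \<rho>)" "\<forall>a. a \<notin> W \<longrightarrow> idx \<rho> (a, 0, 0) = e a"
    unfolding runs_def by metis
  have "runs W k' d (num \<rho>) (\<lambda>a. idx \<rho> (a, 0, 0)) Q"
    using \<rho> by (intro d) auto
  then obtain \<tau> where \<tau>: "exec d \<rho> \<tau>" "ops \<tau> \<le> ops \<rho> + k'" "used \<tau> \<subseteq> used \<rho> \<union> L"
    "peak \<tau> \<le> max (peak \<rho>) bound" "Q (num \<tau>)"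
    "\<forall>a. a \<notin> W \<longrightarrow> idx \<tau> (a, 0, 0) = idx \<rho> (a, 0, 0)"
    unfolding runs_def by metis
  show "\<exists>\<tau>. exec (Seq c d) \<sigma> \<tau> \<and> ops \<tau> \<le> ops \<sigma> + K \<and> used \<tau> \<subseteq> used \<sigma> \<union> L \<and>
       peak \<tau> \<le> max (peak \<sigma>) bound \<and> Q (num \<tau>) \<and>
       (\<forall>a. a \<notin> W \<longrightarrow> idx \<tau> (a, 0, 0) = e a)"
    using \<rho> \<tau> k by (intro exI[of _ \<tau>] conjI exec.Seq[of c \<sigma> \<rho>]) auto
qed

text \<open>Sharper than \<open>runs_Seq\<close>: a complex instruction has one known successor
  memory and keeps all index variables, so straight-line code is executed symbolically.\<close>

lemma runs_Seq_Instr: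
  assumes "nok i e m" "runs W k d (nstep i e m) e Q" "ncost i + k \<le> K"
  shows "runs W K (Seq (Instr i) d) m e Q"
proof -
  have "runs {} (ncost i) (Instr i) m e (\<lambda>m'. m' = nstep i e m)"
    using assms(1) by (rule runs_Instr) auto
  show ?thesis
    unfolding runs_def
  proof (intro allI impI)
    fix \<sigma> :: state assume *: "num \<sigma> = m" and "\<forall>a. idx \<sigma> (a, 0, 0) = e a"
    with \<open>runs {} _ _ _ _ _\<close> obtain \<rho> where \<rho>: "exec (Instr i) \<sigma> \<rho>" "ops \<rho> \<le> ops \<sigma> + ncost i"
      "used \<rho> \<subseteq> used \<sigma> \<union> L" "peak \<rho> \<le> max (peak \<sigma>) bound" "num \<rho> = nstep i e m"
      "\<forall>a. idx \<rho> (a, 0, 0) = e a"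
      unfolding runs_def by auto
    from assms(2) \<rho>(5,6) obtain \<tau> where \<tau>: "exec d \<rho> \<tau>" "ops \<tau> \<le> ops \<rho> + k"
      "used \<tau> \<subseteq> used \<rho> \<union> L" "peak \<tau> \<le> max (peak \<rho>) bound" "Q (num \<tau>)"
      "\<forall>a. a \<notin> W \<longrightarrow> idx \<tau> (a, 0, 0) = e a"
      unfolding runs_def by metis
    show "\<exists>\<tau>. exec (Seq (Instr i) d) \<sigma> \<tau> \<and> ops \<tau> \<le> ops \<sigma> + K \<and> used \<tau> \<subseteq> used \<sigma> \<union> L \<and>
       peak \<tau> \<le> max (peak \<sigma>) bound \<and> Q (num \<tau>) \<and>
       (\<forall>a. a \<notin> W \<longrightarrow> idx \<tau> (a, 0, 0) = e a)"
      using \<rho> \<tau> assms(3) by (intro exI[of _ \<tau>] conjI exec.Seq[of _ \<sigma> \<rho>]) auto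
  qed
qed

lemma runs_Seq_IdxMinus:
  assumes "v \<in> W" "v < 6" "iok a" "iok b" "iv e a - iv e b \<le> bound"
    and d: "runs W k d m (e(v := iv e a - iv e b)) Q"
  shows "runs W k (Seq (Instr (IdxMinus (scalar v) a b)) d) m e Q"
  unfolding runs_def
proof (intro allI impI)
  fix \<sigma> :: state assume m: "num \<sigma> = m" and e: "\<forall>a. idx \<sigma> (a, 0, 0) = e a"
  note [simp] = ival_iv[of \<sigma> e, OF e[rule_format]]
  let ?\<rho> = "step (IdxMinus (scalar v) a b) \<sigma>"
  have \<rho>: "exec (Instr (IdxMinus (scalar v) a b)) \<sigma> ?\<rho>" by (rule exec.Instr) simp
  have \<rho>': "ops ?\<rho> = ops \<sigma>" "used ?\<rho> \<subseteq> used \<sigma> \<union> L" "peak ?\<rho> \<le> max (peak \<sigma>) bound"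
    "num ?\<rho> = m" "\<forall>c. idx ?\<rho> (c, 0, 0) = (e(v := iv e a - iv e b)) c"
    using assms(1-5) m e ilocs_L by (auto simp: write_idx_def xlocs_def L_def)
  from d \<rho>'(4,5) obtain \<tau> where \<tau>: "exec d ?\<rho> \<tau>" "ops \<tau> \<le> ops ?\<rho> + k"
      "used \<tau> \<subseteq> used ?\<rho> \<union> L" "peak \<tau> \<le> max (peak ?\<rho>) bound" "Q (num \<tau>)"
      "\<forall>c. c \<notin> W \<longrightarrow> idx \<tau> (c, 0, 0) = (e(v := iv e a - iv e b)) c"
    unfolding runs_def by metis
  from exec.Seq[OF \<rho> \<tau>(1)] show "\<exists>\<tau>. exec (Seq (Instr (IdxMinus (scalar v) a b)) d) \<sigma> \<tau> \<and>
       ops \<tau> \<le> ops \<sigma> + k \<and> used \<tau> \<subseteq> used \<sigma> \<union> L \<and>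
       peak \<tau> \<le> max (peak \<sigma>) bound \<and> Q (num \<tau>) \<and> (\<forall>a. a \<notin> W \<longrightarrow> idx \<tau> (a, 0, 0) = e a)"
    using \<rho>' \<tau> assms(1) by (intro exI[of _ \<tau>] conjI) (auto simp del: step.simps)
qed

lemma runs_Cond:
  assumes "rok e p" "rok e q"
    and "m (ad e p) = m (ad e q) \<Longrightarrow> runs W k c m e Q"
    and "m (ad e p) \<noteq> m (ad e q) \<Longrightarrow> runs W k d m e Q"
    and "Suc k \<le> K"
  shows "runs W K (Cond (NumEq p q) c d) m e Q"
  unfolding runs_def
proof (intro allI impI)
  fix \<sigma> :: state assume m: "num \<sigma> = m" and e: "\<forall>a. idx \<sigma> (a, 0, 0) = e a"
  note [simp] = addr_ad[of \<sigma> e, OF e[rule_format]]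
  note n = nlocs_L[of \<sigma> e, OF e[rule_format]]
  let ?\<rho> = "charge (NumEq p q) \<sigma>"
  have h: "holds (NumEq p q) \<sigma> \<longleftrightarrow> m (ad e p) = m (ad e q)"
    using m by (auto simp: nval_def)
  let ?c = "if holds (NumEq p q) \<sigma> then c else d"
  have "runs W k ?c m e Q" using assms(3,4) h by auto
  moreover have \<rho>: "num ?\<rho> = m" "\<forall>a. idx ?\<rho> (a, 0, 0) = e a"
    using m e by auto
  ultimately obtain \<tau> where \<tau>: "exec ?c ?\<rho> \<tau>" "ops \<tau> \<le> ops ?\<rho> + k"
      "used \<tau> \<subseteq> used ?\<rho> \<union> L" "peak \<tau> \<le> max (peak ?\<rho>) bound" "Q (num \<tau>)"
      "\<forall>a. a \<notin> W \<longrightarrow> idx \<tau> (a, 0, 0) = e a"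
    unfolding runs_def by metis
  have "exec (Cond (NumEq p q) c d) \<sigma> \<tau>"
    using \<tau>(1) by (auto split: if_splits intro: exec.IfTrue exec.IfFalse simp del: holds.simps charge.simps)
  moreover have "used \<tau> \<subseteq> used \<sigma> \<union> L"
    using \<tau>(3) n[OF assms(1)] n[OF assms(2)] by auto
  ultimately show "\<exists>\<tau>. exec (Cond (NumEq p q) c d) \<sigma> \<tau> \<and>
       ops \<tau> \<le> ops \<sigma> + K \<and> used \<tau> \<subseteq> used \<sigma> \<union> L \<and>
       peak \<tau> \<le> max (peak \<sigma>) bound \<and> Q (num \<tau>) \<and> (\<forall>a. a \<notin> W \<longrightarrow> idx \<tau> (a, 0, 0) = e a)"
    using \<tau> assms(5) by (intro exI[of _ \<tau>] conjI) auto
qed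

text \<open>Starting at or below the limit, which the loop cannot change, the counter leaves the
  loop with exactly the value \<open>iv e h\<close>, where the invariant is read off. Charging
  \<open>iv e h\<close> rounds is crude but suffices.\<close>

lemma runs_For:
  assumes W: "insert v W' \<subseteq> W" "v \<notin> W'" and iok: "v < 6" "iok a" "iok b" "iok h"
    and h: "\<And>w. h = Var w \<Longrightarrow> w \<notin> W"
    and le: "iv e a + iv e b \<le> iv e h" "iv e h \<le> bound"
    and I: "I (iv e a + iv e b) m"
    and body: "\<And>i m e'. iv e a + iv e b \<le> i \<Longrightarrow> i < iv e h \<Longrightarrow> I i m \<Longrightarrow>
      (\<And>a. a \<notin> W \<Longrightarrow> e' a = e a) \<Longrightarrow> e' v = i \<Longrightarrow> runs W' k c m e' (I (Suc i))"
    and Q: "\<And>m. I (iv e h) m \<Longrightarrow> Q m" and K: "iv e h * k \<le> K"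
  shows "runs W K (For v a b h c) m e Q"
proof -
  let ?t = "IdxLess (Var v) h"
  let ?inc = "Instr (IdxPlus (scalar v) (Var v) (Lit 1))"
  let ?w = "While ?t (Seq c ?inc)"
  have hv: "ival \<sigma> h = iv e h" if "\<forall>a. a \<notin> W \<longrightarrow> idx \<sigma> (a, 0, 0) = e a" for \<sigma> :: state
    using that h by (cases h) auto
  \<comment> \<open>Induction on the number \<open>d\<close> of remaining rounds, which also gives
    termination.\<close>
  have loop: "\<exists>\<tau>. exec ?w \<sigma> \<tau> \<and> ops \<tau> \<le> ops \<sigma> + d * k \<and> used \<tau> \<subseteq> used \<sigma> \<union> L \<and>
       peak \<tau> \<le> max (peak \<sigma>) bound \<and> I (iv e h) (num \<tau>) \<and>
       (\<forall>a. a \<notin> W \<longrightarrow> idx \<tau> (a, 0, 0) = e a)"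
    if "\<forall>a. a \<notin> W \<longrightarrow> idx \<sigma> (a, 0, 0) = e a" "idx \<sigma> (v, 0, 0) = i" "i + d = iv e h" "I i (num \<sigma>)"
      "iv e a + iv e b \<le> i"
    for \<sigma> :: state and d i
    using that
  proof (induction d arbitrary: \<sigma> i)
    case 0
    then have "\<not> holds ?t \<sigma>" using hv[of \<sigma>] by auto
    from exec.WhileFalse[OF this] have "exec ?w \<sigma> (charge ?t \<sigma>)" .
    moreover have "used (charge ?t \<sigma>) \<subseteq> used \<sigma> \<union> L"
      using iok ilocs_L[of h] by (auto simp: L_def)
    ultimately show ?case
      using 0 by (intro exI[of _ "charge ?t \<sigma>"] conjI) auto
  next
    case (Suc d)
    let ?\<sigma> = "charge ?t \<sigma>"
    have t: "holds ?t \<sigma>" using hv[of \<sigma>] Suc.prems by auto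
    have \<sigma>: "used ?\<sigma> \<subseteq> used \<sigma> \<union> L"
      using iok ilocs_L[of h] by (auto simp: L_def)
    have "runs W' k c (num \<sigma>) (\<lambda>a. idx \<sigma> (a, 0, 0)) (I (Suc i))"
      using Suc.prems by (intro body) auto
    then obtain \<rho> where \<rho>: "exec c ?\<sigma> \<rho>" "ops \<rho> \<le> ops \<sigma> + k"
      "used \<rho> \<subseteq> used ?\<sigma> \<union> L" "peak \<rho> \<le> max (peak \<sigma>) bound" "I (Suc i) (num \<rho>)"
      "\<forall>a. a \<notin> W' \<longrightarrow> idx \<rho> (a, 0, 0) = idx \<sigma> (a, 0, 0)"
      unfolding runs_def by (elim allE[of _ ?\<sigma>]) auto
    let ?\<rho> = "step (IdxPlus (scalar v) (Var v) (Lit 1)) \<rho>"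
    have inc: "exec ?inc \<rho> ?\<rho>" by (rule exec.Instr) simp
    have v: "idx \<rho> (v, 0, 0) = i" using \<rho>(6) W(2) Suc.prems by auto
    have "\<forall>a. a \<notin> W \<longrightarrow> idx ?\<rho> (a, 0, 0) = e a" "idx ?\<rho> (v, 0, 0) = Suc i" "Suc i + d = iv e h"
      "I (Suc i) (num ?\<rho>)" "iv e a + iv e b \<le> Suc i"
      using Suc.prems \<rho> W v by (auto simp: write_idx_def)
    from Suc.IH[OF this] obtain \<tau> where \<tau>: "exec ?w ?\<rho> \<tau>" "ops \<tau> \<le> ops ?\<rho> + d * k"
      "used \<tau> \<subseteq> used ?\<rho> \<union> L" "peak \<tau> \<le> max (peak ?\<rho>) bound" "I (iv e h) (num \<tau>)"
      "\<forall>a. a \<notin> W \<longrightarrow> idx \<tau> (a, 0, 0) = e a"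
      by blast
    have "ops ?\<rho> = ops \<rho>" "used ?\<rho> \<subseteq> used \<rho> \<union> L" "peak ?\<rho> \<le> max (peak \<rho>) bound"
      using iok v Suc.prems le by (auto simp: write_idx_def xlocs_def L_def)
    moreover from this(2) have "used \<tau> \<subseteq> used \<sigma> \<union> L" using \<rho>(3) \<tau>(3) \<sigma> by blast
    moreover have "ops \<tau> \<le> ops \<sigma> + Suc d * k"
      using \<rho>(2) \<tau>(2) calculation(1) by (simp del: step.simps)
    moreover have "peak \<tau> \<le> max (peak \<sigma>) bound"
      using \<rho>(4) \<tau>(4) calculation(3) by linarith
    ultimately show ?case
      using \<tau>(5,6) exec.WhileTrue[OF t exec.Seq[OF \<rho>(1) inc] \<tau>(1)] by blast
  qed
  show ?thesis
    unfolding runs_def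
  proof (intro allI impI)
    fix \<sigma> :: state assume m: "num \<sigma> = m" and e: "\<forall>a. idx \<sigma> (a, 0, 0) = e a"
    note [simp] = ival_iv[of \<sigma> e, OF e[rule_format]]
    let ?\<rho> = "step (IdxPlus (scalar v) a b) \<sigma>"
    have \<rho>: "exec (Instr (IdxPlus (scalar v) a b)) \<sigma> ?\<rho>" by (rule exec.Instr) simp
    have \<rho>': "ops ?\<rho> = ops \<sigma>" "used ?\<rho> \<subseteq> used \<sigma> \<union> L" "peak ?\<rho> \<le> max (peak \<sigma>) bound"
      using iok le ilocs_L by (auto simp: write_idx_def xlocs_def L_def)
    have "\<forall>a. a \<notin> W \<longrightarrow> idx ?\<rho> (a, 0, 0) = e a" "idx ?\<rho> (v, 0, 0) = iv e a + iv e b"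
      "I (iv e a + iv e b) (num ?\<rho>)"
      using m e I W by (auto simp: write_idx_def)
    from loop[OF this(1,2) _ this(3), of "iv e h - (iv e a + iv e b)"] le
    obtain \<tau> where \<tau>: "exec ?w ?\<rho> \<tau>" "ops \<tau> \<le> ops ?\<rho> + (iv e h - (iv e a + iv e b)) * k"
      "used \<tau> \<subseteq> used ?\<rho> \<union> L" "peak \<tau> \<le> max (peak ?\<rho>) bound" "I (iv e h) (num \<tau>)"
      "\<forall>a. a \<notin> W \<longrightarrow> idx \<tau> (a, 0, 0) = e a"
      by auto
    have "(iv e h - (iv e a + iv e b)) * k \<le> iv e h * k" by (intro mult_right_mono) auto
    with \<rho>'(1) \<tau>(2) K have "ops \<tau> \<le> ops \<sigma> + K" by linarith
    moreover have "used \<tau> \<subseteq> used \<sigma> \<union> L" using \<rho>'(2) \<tau>(3) by blast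
    ultimately show "\<exists>\<tau>. exec (For v a b h c) \<sigma> \<tau> \<and>
       ops \<tau> \<le> ops \<sigma> + K \<and> used \<tau> \<subseteq> used \<sigma> \<union> L \<and>
       peak \<tau> \<le> max (peak \<sigma>) bound \<and> Q (num \<tau>) \<and> (\<forall>a. a \<notin> W \<longrightarrow> idx \<tau> (a, 0, 0) = e a)"
      unfolding For_def using \<rho>' \<tau> K Q exec.Seq[OF \<rho> \<tau>(1)]
      by (intro exI[of _ \<tau>] conjI) (auto simp del: step.simps)
  qed
qed

end

section \<open>Elimination on generators\<close>

text \<open>The active block is selected by the index range \<open>{k..<n}\<close> instead of
  forming smaller matrices, so one and the same \<open>x\<close> serves all elimination steps.
  Nonsingularity appears as a trivial kernel.\<close>

definition nonsingular_system ::
  "nat \<Rightarrow> nat \<Rightarrow> (nat \<Rightarrow> nat \<Rightarrow> complex) \<Rightarrow> (nat \<Rightarrow> complex) \<Rightarrow> (nat \<Rightarrow> complex) \<Rightarrow> bool" where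
  "nonsingular_system n k A b x \<longleftrightarrow>
     (\<forall>i\<in>{k..<n}. (\<Sum>j\<in>{k..<n}. A i j * x j) = b i) \<and>
     (\<forall>v. (\<forall>i\<in>{k..<n}. (\<Sum>j\<in>{k..<n}. A i j * v j) = 0) \<longrightarrow> (\<forall>j\<in>{k..<n}. v j = 0))"

section \<open>Row operations on the system of a trailing block\<close>

lemma nonsingular_system_inj:
  assumes "nonsingular_system n k A b x"
    and "\<And>i. i \<in> {k..<n} \<Longrightarrow> (\<Sum>j\<in>{k..<n}. A i j * v j) = 0" "j \<in> {k..<n}"
  shows "v j = 0"
proof -
  have "\<forall>i\<in>{k..<n}. (\<Sum>j\<in>{k..<n}. A i j * v j) = 0" using assms(2) by blast
  with assms(1)[unfolded nonsingular_system_def, THEN conjunct2, THEN spec, of v]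
  have "\<forall>j\<in>{k..<n}. v j = 0" by (rule mp)
  with assms(3) show ?thesis by blast
qed

lemma nonsingular_system_cong:
  assumes "nonsingular_system n k A b x"
    and "\<And>i j. i \<in> {k..<n} \<Longrightarrow> j \<in> {k..<n} \<Longrightarrow> A' i j = A i j"
    and "\<And>i. i \<in> {k..<n} \<Longrightarrow> b' i = b i"
  shows "nonsingular_system n k A' b' x"
proof -
  have eq: "(\<Sum>j\<in>{k..<n}. A' i j * v j) = (\<Sum>j\<in>{k..<n}. A i j * v j)" if "i \<in> {k..<n}" for i v
    using that assms(2) by (intro sum.cong) auto
  have "nonsingular_system n k A' b' x \<longleftrightarrow> nonsingular_system n k A b x"
    unfolding nonsingular_system_def by (simp only: eq assms(3) cong: ball_cong)
  with assms(1) show ?thesis by blast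
qed

text \<open>Otherwise the unit vector at \<open>k\<close> would lie in the kernel.\<close>

lemma nonsingular_system_pivot:
  assumes "nonsingular_system n k A b x" "k < n"
  shows "\<exists>i\<in>{k..<n}. A i k \<noteq> 0"
proof (rule ccontr)
  assume "\<not> ?thesis"
  moreover have "(\<Sum>j\<in>{k..<n}. A i j * (if j = k then 1 else 0)) = A i k" for i
    using assms(2) by (simp add: if_distrib[of "(*) _"] sum.delta cong: if_cong)
  ultimately have "\<forall>i\<in>{k..<n}. (\<Sum>j\<in>{k..<n}. A i j * (if j = k then 1 else 0)) = 0"
    by auto
  then have "\<forall>j\<in>{k..<n}. (if j = k then 1 else 0) = (0::complex)"
    using assms(1)[unfolded nonsingular_system_def, THEN conjunct2, THEN spec] by (rule mp[rotated])
  from bspec[OF this, of k] assms(2) show False by simp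
qed

definition swap_idx :: "nat \<Rightarrow> nat \<Rightarrow> nat \<Rightarrow> nat" where
  "swap_idx a c i = (if i = a then c else if i = c then a else i)"

lemma nonsingular_system_swap:
  assumes "nonsingular_system n k A b x" "a \<in> {k..<n}" "c \<in> {k..<n}"
  shows "nonsingular_system n k (\<lambda>i. A (swap_idx a c i)) (\<lambda>i. b (swap_idx a c i)) x"
proof -
  have 1: "swap_idx a c i \<in> {k..<n}" if "i \<in> {k..<n}" for i
    using that assms(2,3) by (auto simp: swap_idx_def)
  have 2: "swap_idx a c (swap_idx a c i) = i" for i
    by (auto simp: swap_idx_def)
  show ?thesis
    unfolding nonsingular_system_def
  proof (intro conjI ballI allI impI)
    fix i assume "i \<in> {k..<n}"
    then show "(\<Sum>j\<in>{k..<n}. A (swap_idx a c i) j * x j) = b (swap_idx a c i)"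
      using assms(1) 1 unfolding nonsingular_system_def by blast
  next
    fix v j
    assume v: "\<forall>i\<in>{k..<n}. (\<Sum>j\<in>{k..<n}. A (swap_idx a c i) j * v j) = 0" and j: "j \<in> {k..<n}"
    have "\<forall>i\<in>{k..<n}. (\<Sum>j\<in>{k..<n}. A i j * v j) = 0"
    proof
      fix i assume "i \<in> {k..<n}"
      with v[rule_format, OF 1, of i] show "(\<Sum>j\<in>{k..<n}. A i j * v j) = 0" by (simp add: 2)
    qed
    with assms(1) j show "v j = 0" unfolding nonsingular_system_def by blast
  qed
qed

text \<open>A row of the Schur complement, applied to the trailing part of a vector, equals row
  \<open>i\<close> minus a multiple of row \<open>k\<close>, applied to the whole vector. This
  transports the solution and, after an extension at \<open>k\<close>, kernel vectors.\<close>

lemma nonsingular_system_eliminate: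
  assumes A: "nonsingular_system n k A b x" and k: "k < n" and piv: "A k k \<noteq> 0"
  shows "nonsingular_system n (Suc k) (\<lambda>i j. A i j - A i k * A k j / A k k)
    (\<lambda>i. b i - A i k / A k k * b k) x"
proof -
  have split: "(\<Sum>j\<in>{k..<n}. A i j * v j) = A i k * v k + (\<Sum>j\<in>{Suc k..<n}. A i j * v j)" for i v
    using k by (simp add: sum.atLeast_Suc_lessThan)
  have schur: "(\<Sum>j\<in>{Suc k..<n}. (A i j - A i k * A k j / A k k) * v j) =
    (\<Sum>j\<in>{k..<n}. A i j * v j) - A i k / A k k * (\<Sum>j\<in>{k..<n}. A k j * v j)" for i v
  proof -
    have "(\<Sum>j\<in>{Suc k..<n}. (A i j - A i k * A k j / A k k) * v j) =
      (\<Sum>j\<in>{Suc k..<n}. A i j * v j - A i k / A k k * (A k j * v j))"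
      by (intro sum.cong) (auto simp: left_diff_distrib)
    also have "\<dots> = (\<Sum>j\<in>{Suc k..<n}. A i j * v j) - A i k / A k k * (\<Sum>j\<in>{Suc k..<n}. A k j * v j)"
      by (simp only: sum_subtractf sum_distrib_left)
    finally show ?thesis
      unfolding split distrib_left using piv by simp
  qed
  have sol: "(\<Sum>j\<in>{k..<n}. A i j * x j) = b i" if "i \<in> {k..<n}" for i
    using A that unfolding nonsingular_system_def by blast
  have inj: "\<forall>j\<in>{k..<n}. v j = 0" if "\<forall>i\<in>{k..<n}. (\<Sum>j\<in>{k..<n}. A i j * v j) = 0" for v
    using A[unfolded nonsingular_system_def, THEN conjunct2, THEN spec] that by (rule mp)
  show ?thesis
    unfolding nonsingular_system_def
  proof (intro conjI ballI allI impI)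
    fix i assume "i \<in> {Suc k..<n}"
    then show "(\<Sum>j\<in>{Suc k..<n}. (A i j - A i k * A k j / A k k) * x j) = b i - A i k / A k k * b k"
      using k unfolding schur by (simp add: sol)
  next
    fix v j
    assume v: "\<forall>i\<in>{Suc k..<n}. (\<Sum>j\<in>{Suc k..<n}. (A i j - A i k * A k j / A k k) * v j) = 0"
      and j: "j \<in> {Suc k..<n}"
    \<comment> \<open>The component at \<open>k\<close> is chosen such that row \<open>k\<close>
      annihilates \<open>w\<close>; by \<open>schur\<close> the other rows then do so as
      well.\<close>
    define w where "w = v(k := - (\<Sum>j\<in>{Suc k..<n}. A k j * v j) / A k k)"
    have vw: "(\<Sum>j\<in>{Suc k..<n}. f j * v j) = (\<Sum>j\<in>{Suc k..<n}. f j * w j)" for f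
      by (intro sum.cong) (auto simp: w_def)
    have row: "(\<Sum>j\<in>{k..<n}. A k j * w j) = 0"
      unfolding split vw[symmetric] using piv by (simp add: w_def)
    have "(\<Sum>j\<in>{k..<n}. A i j * w j) = 0" if "i \<in> {k..<n}" for i
    proof (cases "i = k")
      case False
      with v that have "(\<Sum>j\<in>{Suc k..<n}. (A i j - A i k * A k j / A k k) * v j) = 0" by auto
      then show ?thesis unfolding vw schur row by simp
    qed (simp add: row)
    then have "\<forall>j\<in>{k..<n}. w j = 0" by (rule inj[OF ballI])
    from bspec[OF this, of j] j show "v j = 0" by (simp add: w_def)
  qed
qed

text \<open>With \<open>c = l / a\<close> and \<open>d = u / a\<close>, the three correction terms
  of the expanded product combine to \<open>c * d * a\<close> times
  \<open>- (t' - s) - (t - s') + (t - s) = - (t' - s')\<close>. The denominator of the entry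
  cancels.\<close>

lemma cauchy_like_schur_complement:
  fixes g g' h h' :: "nat \<Rightarrow> complex"
  assumes "(\<Sum>p<r. g p * h p) = (t - s) * a" "(\<Sum>p<r. g' p * h p) = (t' - s) * l"
    "(\<Sum>p<r. g p * h' p) = (t - s') * u" "a \<noteq> 0" "t' \<noteq> s'"
  shows "(\<Sum>p<r. (g' p - l / a * g p) * (h' p - u / a * h p)) / (t' - s') =
    (\<Sum>p<r. g' p * h' p) / (t' - s') - l * u / a"
proof -
  define c d where "c = l / a" and "d = u / a"
  then have lu: "l = c * a" "u = d * a" using assms(4) by auto
  have "(\<Sum>p<r. (g' p - c * g p) * (h' p - d * h p)) =
    (\<Sum>p<r. g' p * h' p - d * (g' p * h p) - c * (g p * h' p) + c * d * (g p * h p))"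
    by (intro sum.cong) (auto simp: algebra_simps)
  also have "\<dots> = (\<Sum>p<r. g' p * h' p) - d * (\<Sum>p<r. g' p * h p) - c * (\<Sum>p<r. g p * h' p)
    + c * d * (\<Sum>p<r. g p * h p)"
    by (simp only: sum.distrib sum_subtractf sum_distrib_left)
  also have "\<dots> = (\<Sum>p<r. g' p * h' p) - c * d * a * (t' - s')"
    unfolding assms(1-3) lu by (simp add: algebra_simps)
  finally have "(\<Sum>p<r. (g' p - c * g p) * (h' p - d * h p)) / (t' - s') =
    (\<Sum>p<r. g' p * h' p) / (t' - s') - c * d * a"
    using assms(5) by (simp add: diff_divide_distrib)
  then show ?thesis using assms(4) by (simp add: c_def d_def)
qed

text \<open>
  In terms of the \<^emph>\<open>updated\<close> generator row, the entry is
  determined up to the factor \<open>s - s'\<close>, so it has to be remembered only when \<open>s = s'\<close>.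
\<close>

lemma updated_generator_entry:
  fixes g h h' :: "nat \<Rightarrow> complex"
  assumes "(\<Sum>p<r. g p * h p) = (t - s) * a" "(\<Sum>p<r. g p * h' p) = (t - s') * u" "a \<noteq> 0"
  shows "(\<Sum>p<r. g p * (h' p - u / a * h p)) = (s - s') * u"
proof -
  have "(\<Sum>p<r. g p * (h' p - u / a * h p)) = (\<Sum>p<r. g p * h' p - u / a * (g p * h p))"
    by (intro sum.cong) (auto simp: right_diff_distrib)
  also have "\<dots> = (\<Sum>p<r. g p * h' p) - u / a * (\<Sum>p<r. g p * h p)"
    by (simp only: sum_subtractf sum_distrib_left)
  also have "\<dots> = (s - s') * u"
    unfolding assms(1,2) using assms(3) by (simp add: algebra_simps)
  finally show ?thesis .
qed

text \<open>More than \<open>r\<close> columns with knot \<open>c\<close> would belong to linearly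
  dependent rows of \<open>H\<close>, which have length \<open>r\<close>. The denominators
  \<open>t i - c\<close> do not depend on the column, so the dependence, extended by zero, would be
  a nonzero kernel vector.\<close>

lemma card_coincidences:
  fixes G H :: "nat \<Rightarrow> nat \<Rightarrow> complex"
  assumes inj: "\<And>v. (\<And>i. i < n \<Longrightarrow> (\<Sum>j<n. (\<Sum>p<r. G i p * H j p) / (t i - s j) * v j) = 0) \<Longrightarrow>
      (\<And>j. j < n \<Longrightarrow> v j = 0)"
  shows "card {j. j < n \<and> s j = (c::complex)} \<le> r"
proof (rule ccontr)
  let ?J = "{j. j < n \<and> s j = c}"
  assume "\<not> ?thesis"
  then have "Suc r \<le> card ?J" by simp
  then obtain J where J: "J \<subseteq> ?J" "card J = Suc r"
    by (meson obtain_subset_with_card_n)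
  then have "finite J" by (intro card_ge_0_finite) simp
  with J obtain f where f: "bij_betw f {..<Suc r} J"
    using ex_bij_betw_nat_finite[of J] by (auto simp: atLeast0LessThan)
  \<comment> \<open>Column \<open>q\<close> is the generator row \<open>H (f q)\<close> padded by a
    zero. The resulting zero row makes the square matrix singular and yields the coefficients
    \<open>w\<close> of a dependence.\<close>
  define A where "A = mat\<^sub>r (Suc r) (Suc r)
    (\<lambda>p. if p = r then 0\<^sub>v (Suc r) else vec (Suc r) (\<lambda>q. H (f q) p))"
  have A: "A \<in> carrier_mat (Suc r) (Suc r)" by (simp add: A_def)
  have "det A = 0" unfolding A_def by (rule det_row_0) auto
  then obtain w where w: "w \<in> carrier_vec (Suc r)" "w \<noteq> 0\<^sub>v (Suc r)" "A *\<^sub>v w = 0\<^sub>v (Suc r)"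
    using det_0_iff_vec_prod_zero[OF A] by blast
  define v where "v j = (if j \<in> J then w $ (the_inv_into {..<Suc r} f j) else 0)" for j
  have vf: "v (f q) = w $ q" if "q < Suc r" for q
    using that f by (auto simp: v_def bij_betw_def the_inv_into_f_f)
  have Hv: "(\<Sum>j\<in>J. H j p * v j) = 0" if p: "p < r" for p
  proof -
    have "(\<Sum>j\<in>J. H j p * v j) = (\<Sum>q<Suc r. H (f q) p * v (f q))"
      using sum.reindex_bij_betw[OF f, of "\<lambda>j. H j p * v j"] by simp
    also have "\<dots> = (\<Sum>q<Suc r. H (f q) p * w $ q)" by (intro sum.cong) (auto simp: vf)
    also have "\<dots> = (A *\<^sub>v w) $ p"
      using p w(1) by (auto simp: A_def scalar_prod_def atLeast0LessThan intro!: sum.cong)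
    finally show ?thesis using p w(3) by simp
  qed
  have "(\<Sum>j<n. (\<Sum>p<r. G i p * H j p) / (t i - s j) * v j) = 0" for i
  proof -
    have "(\<Sum>j<n. (\<Sum>p<r. G i p * H j p) / (t i - s j) * v j) =
      (\<Sum>j\<in>J. (\<Sum>p<r. G i p * H j p) / (t i - s j) * v j)"
      using J(1) by (intro sum.mono_neutral_right) (auto simp: v_def)
    also have "\<dots> = (\<Sum>j\<in>J. (\<Sum>p<r. G i p * (H j p * v j)) / (t i - c))"
      using J(1) by (intro sum.cong) (auto simp: sum_distrib_right mult.assoc)
    also have "\<dots> = (\<Sum>j\<in>J. \<Sum>p<r. G i p * (H j p * v j)) / (t i - c)"
      by (simp add: sum_divide_distrib)
    also have "(\<Sum>j\<in>J. \<Sum>p<r. G i p * (H j p * v j)) = (\<Sum>p<r. G i p * (\<Sum>j\<in>J. H j p * v j))"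
      unfolding sum_distrib_left by (rule sum.swap)
    finally show ?thesis by (simp add: Hv)
  qed
  then have "v j = 0" if "j < n" for j by (rule inj[OF _ that])
  then have "w $ q = 0" if "q < Suc r" for q
    using that f J(1) vf[OF that] by (auto simp: bij_betw_def)
  then have "w = 0\<^sub>v (Suc r)" using w(1) by auto
  with w(2) show False ..
qed

section \<open>The program\<close>

text \<open>
  Arrays 0 to 4 hold the input, 5 the solution, 6 the entries of the upper triangular factor at
  pairs of equal column knots, and 7 to 12 scalars: 7 the last computed entry, 8 a temporary,
  9 the pivot, 10 zero, 11 the multiplier, 12 the accumulator of the back substitution. Index variables: 0 and 1 hold
  \<open>n\<close> and \<open>r\<close>, 2 is the elimination step, 3 and 4 are inner loop counters, 5 counts the
  backward steps.
\<close>

definition dot_com :: "nat \<Rightarrow> nat \<Rightarrow> com" where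
  "dot_com u v = Seq (Instr (NumConst (scalar 7) 0)) (For 4 (Lit 0) (Lit 0) (Var 1)
     (Seq (Instr (NumArith Times (scalar 8) (Ref 2 (Var u) (Var 4)) (Ref 3 (Var v) (Var 4))))
       (Instr (NumArith Plus (scalar 7) (scalar 7) (scalar 8)))))"

text \<open>\<open>a\<close> names the array of left knots. With 0 the result is an entry of the
  current Schur complement; with 1 the denominator is a difference of two column knots, which
  recovers an entry of the triangular factor from updated generators.\<close>

definition entry_com :: "nat \<Rightarrow> nat \<Rightarrow> nat \<Rightarrow> com" where
  "entry_com a u v = Seq (dot_com u v)
     (Seq (Instr (NumArith Minus (scalar 8) (Ref a (Var u) (Lit 0)) (Ref 1 (Var v) (Lit 0))))
       (Instr (NumArith Divide (scalar 7) (scalar 7) (scalar 8))))"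

definition axpy_com :: "arith \<Rightarrow> nat \<Rightarrow> nat \<Rightarrow> nat \<Rightarrow> com" where
  "axpy_com f a u w = For 4 (Lit 0) (Lit 0) (Var 1)
     (Seq (Instr (NumArith Times (scalar 8) (scalar 11) (Ref a (Var w) (Var 4))))
       (Instr (NumArith f (Ref a (Var u) (Var 4)) (Ref a (Var u) (Var 4)) (scalar 8))))"

definition swap_cells :: "ref \<Rightarrow> ref \<Rightarrow> com \<Rightarrow> com" where
  "swap_cells p q c = Seq (Instr (NumCopy (scalar 8) p)) (Seq (Instr (NumCopy p q))
     (Seq (Instr (NumCopy q (scalar 8))) c))"

text \<open>A row exchange of the matrix permutes the row knots, the right-hand side and the rows of
  \<open>G\<close>. Columns are never exchanged, so the unknowns keep their order.\<close>

definition swap_com :: "nat \<Rightarrow> nat \<Rightarrow> com" where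
  "swap_com u w =
     swap_cells (Ref 0 (Var u) (Lit 0)) (Ref 0 (Var w) (Lit 0))
     (swap_cells (Ref 4 (Var u) (Lit 0)) (Ref 4 (Var w) (Lit 0))
     (For 4 (Lit 0) (Lit 0) (Var 1) (swap_cells (Ref 2 (Var u) (Var 4)) (Ref 2 (Var w) (Var 4)) Skip)))"

text \<open>In exact arithmetic any nonzero pivot will do. Each candidate row is brought into
  position \<open>k\<close> until one gives a nonzero pivot; the first round exchanges row
  \<open>k\<close> with itself.\<close>

definition pivot_com :: com where
  "pivot_com = Seq (Instr (NumConst (scalar 9) 0)) (For 3 (Var 2) (Lit 0) (Var 0)
     (Cond (NumEq (scalar 9) (scalar 10))
       (Seq (swap_com 2 3) (Seq (entry_com 0 2 2) (Instr (NumCopy (scalar 9) (scalar 7)))))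
       Skip))"

text \<open>One pass treats index \<open>i\<close> both as a column and as a row, so each multiplier
  is used at once and needs only a scalar cell.\<close>

definition eliminate_row_column :: com where
  "eliminate_row_column =
     Seq (entry_com 0 2 3)
     (Seq (Cond (NumEq (Ref 1 (Var 2) (Lit 0)) (Ref 1 (Var 3) (Lit 0)))
       (Instr (NumCopy (Ref 6 (Var 2) (Var 3)) (scalar 7))) Skip)
     (Seq (Instr (NumArith Divide (scalar 11) (scalar 7) (scalar 9)))
     (Seq (axpy_com Minus 3 3 2)
     (Seq (entry_com 0 3 2)
     (Seq (Instr (NumArith Divide (scalar 11) (scalar 7) (scalar 9)))
     (Seq (axpy_com Minus 2 3 2)
     (Seq (Instr (NumArith Times (scalar 8) (scalar 11) (Ref 4 (Var 2) (Lit 0))))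
     (Instr (NumArith Minus (Ref 4 (Var 3) (Lit 0)) (Ref 4 (Var 3) (Lit 0)) (scalar 8))))))))))"

definition forward_com :: com where
  "forward_com = Seq pivot_com (For 3 (Var 2) (Lit 1) (Var 0) eliminate_row_column)"

definition restore_row :: com where
  "restore_row =
     Seq (Cond (NumEq (Ref 1 (Var 2) (Lit 0)) (Ref 1 (Var 3) (Lit 0)))
       (Instr (NumCopy (scalar 7) (Ref 6 (Var 2) (Var 3)))) (entry_com 1 2 3))
     (Seq (Instr (NumArith Times (scalar 8) (scalar 7) (Ref 5 (Var 3) (Lit 0))))
     (Seq (Instr (NumArith Minus (scalar 12) (scalar 12) (scalar 8)))
     (Seq (Instr (NumArith Divide (scalar 11) (scalar 7) (scalar 9)))
     (axpy_com Plus 3 3 2))))"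

definition backward_com :: com where
  "backward_com =
     Seq (entry_com 0 2 2)
     (Seq (Instr (NumCopy (scalar 9) (scalar 7)))
     (Seq (Instr (NumCopy (scalar 12) (Ref 4 (Var 2) (Lit 0))))
     (Seq (For 3 (Var 2) (Lit 1) (Var 0) restore_row)
     (Instr (NumArith Divide (Ref 5 (Var 2) (Lit 0)) (scalar 12) (scalar 9))))))"

text \<open>Conjugating \<open>H\<close> in place turns products with the adjoint into plain sums.
  \<open>For\<close> only counts upwards, so the backward phase derives its step as
  \<open>n - 1\<close> minus the counter.\<close>

definition gko_com :: com where
  "gko_com =
     Seq (For 3 (Lit 0) (Lit 0) (Var 0) (For 4 (Lit 0) (Lit 0) (Var 1)
       (Instr (NumConj (Ref 3 (Var 3) (Var 4)) (Ref 3 (Var 3) (Var 4))))))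
     (Seq (Instr (NumConst (scalar 10) 0))
     (Seq (For 2 (Lit 0) (Lit 0) (Var 0) forward_com)
     (For 5 (Lit 0) (Lit 0) (Var 0)
       (Seq (Instr (IdxMinus (scalar 2) (Var 0) (Var 5)))
       (Seq (Instr (IdxMinus (scalar 2) (Var 2) (Lit 1))) backward_com)))))"

text \<open>Only the size of array 6 is not evident from the shape of its clause: for a nonsingular
  matrix \<open>card_coincidences\<close> leaves at most \<open>r\<close> cells per row.\<close>

fun allowed :: "nat \<Rightarrow> nat \<Rightarrow> (nat \<Rightarrow> complex) \<Rightarrow> cell \<Rightarrow> bool" where
  "allowed n r s (a, i, j) \<longleftrightarrow>
     a \<in> {0, 1, 4, 5} \<and> i < n \<and> j = 0 \<or>
     a \<in> {2, 3} \<and> i < n \<and> j < r \<or>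
     a = 6 \<and> i < n \<and> j < n \<and> s i = s j \<or>
     a \<in> {7, 8, 9, 10, 11, 12} \<and> i = 0 \<and> j = 0"

text \<open>\<open>s\<close> and \<open>x\<close> are parameters because they stay the same
  throughout; row knots, right-hand side and generators change during the run and are read from the
  memory.\<close>

locale gko = resources "allowed n r s" "max n r" for n r :: nat and s :: "nat \<Rightarrow> complex" +
  fixes x :: "nat \<Rightarrow> complex"
begin

definition entry :: "mem \<Rightarrow> nat \<Rightarrow> nat \<Rightarrow> nat \<Rightarrow> complex" where
  "entry m a i j = (\<Sum>p<r. m (2, i, p) * m (3, j, p)) / (m (a, i, 0) - m (1, j, 0))"

section \<open>Correctness and cost of the building blocks\<close>

lemma runs_dot:
  assumes "e 1 = r" "e u < n" "e v < n" "u < 6" "v < 6" "u \<noteq> 4" "v \<noteq> 4"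
  shows "runs {4} (2 * r) (dot_com u v) m e
    (\<lambda>m'. m' (7, 0, 0) = (\<Sum>p<r. m (2, e u, p) * m (3, e v, p)) \<and>
      (\<forall>a i j. a \<noteq> 7 \<longrightarrow> a \<noteq> 8 \<longrightarrow> m' (a, i, j) = m (a, i, j)))"
  unfolding dot_com_def
proof (rule runs_Seq_Instr)
  show "runs {4} (2 * r) (For 4 (Lit 0) (Lit 0) (Var 1)
     (Seq (Instr (NumArith Times (scalar 8) (Ref 2 (Var u) (Var 4)) (Ref 3 (Var v) (Var 4))))
       (Instr (NumArith Plus (scalar 7) (scalar 7) (scalar 8)))))
     (nstep (NumConst (scalar 7) 0) e m) e
    (\<lambda>m'. m' (7, 0, 0) = (\<Sum>p<r. m (2, e u, p) * m (3, e v, p)) \<and>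
      (\<forall>a i j. a \<noteq> 7 \<longrightarrow> a \<noteq> 8 \<longrightarrow> m' (a, i, j) = m (a, i, j)))"
  proof (rule runs_For[where W' = "{}" and k = 2 and
        I = "\<lambda>i m'. m' (7, 0, 0) = (\<Sum>p<i. m (2, e u, p) * m (3, e v, p)) \<and>
          (\<forall>a i j. a \<noteq> 7 \<longrightarrow> a \<noteq> 8 \<longrightarrow> m' (a, i, j) = m (a, i, j))"], goal_cases)
    case (11 i m' e')
    then have "e' u = e u" "e' v = e v" using assms by auto
    with 11 assms show ?case
      by (intro runs_Seq_Instr[where k = 1] runs_Instr) auto
  qed (use assms in auto)
qed (use assms in auto)

lemma runs_entry:
  assumes "e 1 = r" "e u < n" "e v < n" "u < 6" "v < 6" "u \<noteq> 4" "v \<noteq> 4"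
    and "a = 0 \<or> a = 1" "m (a, e u, 0) \<noteq> m (1, e v, 0)"
  shows "runs {4} (2 * r + 2) (entry_com a u v) m e
    (\<lambda>m'. m' (7, 0, 0) = entry m a (e u) (e v) \<and>
      (\<forall>a i j. a \<noteq> 7 \<longrightarrow> a \<noteq> 8 \<longrightarrow> m' (a, i, j) = m (a, i, j)))"
  unfolding entry_com_def
proof (rule runs_Seq[OF runs_dot[OF assms(1-7)], where k' = 2], goal_cases)
  case (1 m' e')
  then have "e' u = e u" "e' v = e v" using assms by auto
  with 1 assms show ?case
    by (intro runs_Seq_Instr[where k = 1] runs_Instr) (auto simp: entry_def)
qed auto

lemma runs_axpy:
  assumes "e 1 = r" "e u < n" "e w < n" "u < 6" "w < 6" "u \<noteq> 4" "w \<noteq> 4"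
    and "a = 2 \<or> a = 3" "f \<noteq> Divide" "e u \<noteq> e w"
  shows "runs {4} (2 * r) (axpy_com f a u w) m e
    (\<lambda>m'. \<forall>b q p. b \<noteq> 8 \<longrightarrow> m' (b, q, p) = (if b = a \<and> q = e u \<and> p < r
      then arith_val f (m (a, e u, p)) (m (11, 0, 0) * m (a, e w, p)) else m (b, q, p)))"
  unfolding axpy_com_def
proof (rule runs_For[where W' = "{}" and k = 2 and
        I = "\<lambda>i m'. \<forall>b q p. b \<noteq> 8 \<longrightarrow> m' (b, q, p) = (if b = a \<and> q = e u \<and> p < i
      then arith_val f (m (a, e u, p)) (m (11, 0, 0) * m (a, e w, p)) else m (b, q, p))"], goal_cases)
  case (11 i m' e')
  then have "e' u = e u" "e' w = e w" using assms by auto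
  with 11 assms show ?case
    by (intro runs_Seq_Instr[where k = 1] runs_Instr) (auto simp: less_Suc_eq)
qed (use assms in auto)

lemma runs_swap_cells:
  assumes "runs W k c (m(ad e q := m (ad e p), ad e p := m (ad e q), (8, 0, 0) := m (ad e p))) e Q"
    "rok e p" "rok e q" "ad e p \<noteq> (8, 0, 0)" "ad e q \<noteq> (8, 0, 0)"
  shows "runs W k (swap_cells p q c) m e Q"
proof -
  have "m(ad e q := m (ad e p), ad e p := m (ad e q), (8, 0, 0) := m (ad e p)) =
    nstep (NumCopy q (scalar 8)) e (nstep (NumCopy p q) e (nstep (NumCopy (scalar 8) p) e m))"
    using assms(4,5) by (auto simp: fun_eq_iff)
  with assms show ?thesis
    unfolding swap_cells_def by (intro runs_Seq_Instr[where k = k]) auto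
qed

lemma runs_swap:
  assumes "e 1 = r" "e u < n" "e w < n" "u < 6" "w < 6" "u \<noteq> 4" "w \<noteq> 4"
  shows "runs {4} 0 (swap_com u w) m e
    (\<lambda>m'. \<forall>b q p. b \<noteq> 8 \<longrightarrow> m' (b, q, p) = (if (b = 0 \<or> b = 4) \<and> p = 0 \<or> b = 2 \<and> p < r
      then m (b, swap_idx (e u) (e w) q, p) else m (b, q, p)))"
  unfolding swap_com_def
proof (intro runs_swap_cells, goal_cases)
  case 1
  show ?case
  proof (rule runs_For[where W' = "{}" and k = 0 and
    I = "\<lambda>i m'. \<forall>b q p. b \<noteq> 8 \<longrightarrow> m' (b, q, p) = (if (b = 0 \<or> b = 4) \<and> p = 0 \<or> b = 2 \<and> p < i
      then m (b, swap_idx (e u) (e w) q, p) else m (b, q, p))"], goal_cases)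
    case 10
    then show ?case by (auto simp: swap_idx_def)
  next
    case (11 i m' e')
    then have "e' u = e u" "e' w = e w" using assms by auto
    with 11 assms show ?case
      by (intro runs_swap_cells runs_Skip) (auto simp: less_Suc_eq swap_idx_def)
  qed (use assms in auto)
qed (use assms in auto)

subsection \<open>Forward phase\<close>

lemma entry_cong:
  assumes "\<And>p. p < r \<Longrightarrow> m' (2, i, p) = m (2, i', p)" "\<And>p. p < r \<Longrightarrow> m' (3, j, p) = m (3, j', p)"
    "m' (a, i, 0) = m (a, i', 0)" "m' (1, j, 0) = m (1, j', 0)"
  shows "entry m' a i j = entry m a i' j'"
  unfolding entry_def using assms by (intro arg_cong2[where f = "(/)"] sum.cong) auto

text \<open>
  \<open>history k m h\<close>: the rows of the upper triangular factor before \<open>k\<close> are consistent with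
  the generators in \<open>m\<close>, when \<open>h\<close> is the right generator after \<open>k\<close> steps. All memory needed
  to undo the updates of \<open>h\<close> is in \<open>m\<close>.
\<close>

fun history :: "nat \<Rightarrow> mem \<Rightarrow> (nat \<Rightarrow> nat \<Rightarrow> complex) \<Rightarrow> bool" where
  "history 0 m h' \<longleftrightarrow> True"
| "history (Suc k) m h' \<longleftrightarrow> (\<exists>h a. history k m h \<and>
     (\<forall>j<n. (\<Sum>p<r. m (2, k, p) * h j p) = (m (0, k, 0) - s j) * a j) \<and> a k \<noteq> 0 \<and>
     (\<forall>j<n. \<forall>p<r. h' j p = (if k < j then h j p - a j / a k * h k p else h j p)) \<and>
     (\<forall>j<n. k < j \<longrightarrow> s j = s k \<longrightarrow> m (6, k, j) = a j) \<and>
     (\<Sum>j\<in>{k..<n}. a j * x j) = m (4, k, 0))"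

text \<open>The record of the first \<open>k\<close> steps reads only rows below \<open>k\<close> of
  arrays 0, 2, 4 and 6. Later row exchanges and eliminations leave these alone, so the record
  survives until the backward phase.\<close>

lemma history_cong:
  assumes "history k m h" "k \<le> n"
    and "\<And>q. q < k \<Longrightarrow> m' (0, q, 0) = m (0, q, 0)" "\<And>q. q < k \<Longrightarrow> m' (4, q, 0) = m (4, q, 0)"
    and "\<And>q p. q < k \<Longrightarrow> p < r \<Longrightarrow> m' (2, q, p) = m (2, q, p)"
    and "\<And>q j. q < k \<Longrightarrow> j < n \<Longrightarrow> m' (6, q, j) = m (6, q, j)"
    and "\<And>j p. j < n \<Longrightarrow> p < r \<Longrightarrow> h' j p = h j p"
  shows "history k m' h'"
  using assms
proof (induction k arbitrary: h h')
  case (Suc k)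
  from Suc.prems(1) obtain g a where g: "history k m g"
    and dot: "\<forall>j<n. (\<Sum>p<r. m (2, k, p) * g j p) = (m (0, k, 0) - s j) * a j" and "a k \<noteq> 0"
    and h: "\<forall>j<n. \<forall>p<r. h j p = (if k < j then g j p - a j / a k * g k p else g j p)"
    and stored: "\<forall>j<n. k < j \<longrightarrow> s j = s k \<longrightarrow> m (6, k, j) = a j"
    and row: "(\<Sum>j\<in>{k..<n}. a j * x j) = m (4, k, 0)"
    unfolding history.simps by blast
  show ?case
    unfolding history.simps
  proof (intro exI conjI)
    show "history k m' g"
      by (rule Suc.IH[OF g]) (use Suc.prems(2-6) in auto)
    have "(\<Sum>p<r. m' (2, k, p) * g j p) = (\<Sum>p<r. m (2, k, p) * g j p)" for j
      using Suc.prems(5)[of k] by (intro sum.cong) auto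
    then show "\<forall>j<n. (\<Sum>p<r. m' (2, k, p) * g j p) = (m' (0, k, 0) - s j) * a j"
      using dot Suc.prems(3)[of k] by simp
    show "\<forall>j<n. \<forall>p<r. h' j p = (if k < j then g j p - a j / a k * g k p else g j p)"
      using h Suc.prems(7) by simp
    show "\<forall>j<n. k < j \<longrightarrow> s j = s k \<longrightarrow> m' (6, k, j) = a j"
      using stored Suc.prems(6)[of k] by simp
    show "(\<Sum>j\<in>{k..<n}. a j * x j) = m' (4, k, 0)"
      using row Suc.prems(4)[of k] by simp
  qed fact
qed simp

text \<open>The matrix is never stored: \<open>entry m 0\<close> reads the current Schur complement
  off the generators. The solution of the original system solves every trailing system.\<close>

definition forward_inv :: "nat \<Rightarrow> mem \<Rightarrow> bool" where
  "forward_inv k m \<longleftrightarrow> (\<forall>j<n. m (1, j, 0) = s j) \<and> (\<forall>i<n. \<forall>j<n. m (0, i, 0) \<noteq> s j) \<and>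
     m (10, 0, 0) = 0 \<and> nonsingular_system n k (entry m 0) (\<lambda>i. m (4, i, 0)) x \<and>
     history k m (\<lambda>j p. m (3, j, p))"

lemma forward_inv_frame:
  assumes "forward_inv k m" "k \<le> n"
    and "\<And>b q p. b \<noteq> 7 \<Longrightarrow> b \<noteq> 8 \<Longrightarrow> b \<noteq> 9 \<Longrightarrow> b \<noteq> 11 \<Longrightarrow> m' (b, q, p) = m (b, q, p)"
  shows "forward_inv k m'"
proof -
  have "entry m' 0 = entry m 0"
    by (intro ext entry_cong assms(3)) auto
  moreover have "history k m' (\<lambda>j p. m' (3, j, p))"
    by (rule history_cong[where m = m and h = "\<lambda>j p. m (3, j, p)"])
      (use assms(1,2) in \<open>auto simp: assms(3) forward_inv_def\<close>)
  ultimately show ?thesis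
    using assms(1) unfolding forward_inv_def by (simp add: assms(3))
qed

lemma forward_inv_swap:
  assumes m: "forward_inv k m" and i: "i \<in> {k..<n}"
    and m': "\<And>b q p. b \<noteq> 8 \<Longrightarrow> m' (b, q, p) = (if (b = 0 \<or> b = 4) \<and> p = 0 \<or> b = 2 \<and> p < r
      then m (b, swap_idx k i q, p) else m (b, q, p))"
  shows "forward_inv k m'" and "entry m' 0 q j = entry m 0 (swap_idx k i q) j"
proof -
  have entry: "entry m' 0 q j = entry m 0 (swap_idx k i q) j" for q j
    by (intro entry_cong) (auto simp: m')
  then show "entry m' 0 q j = entry m 0 (swap_idx k i q) j" .
  have "nonsingular_system n k (entry m' 0) (\<lambda>i. m' (4, i, 0)) x"
    by (rule nonsingular_system_cong[OF
          nonsingular_system_swap[of n k "entry m 0" "\<lambda>i. m (4, i, 0)" x k i]])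
      (use m i in \<open>auto simp: forward_inv_def entry m'\<close>)
  moreover have "history k m' (\<lambda>j p. m' (3, j, p))"
    by (rule history_cong[where m = m and h = "\<lambda>j p. m (3, j, p)"])
      (use m i in \<open>auto simp: m' swap_idx_def forward_inv_def\<close>)
  moreover have "swap_idx k i q < n" if "q < n" for q
    using that i by (auto simp: swap_idx_def)
  ultimately show "forward_inv k m'"
    using m unfolding forward_inv_def by (auto simp: m')
qed

lemma runs_pivot:
  assumes m: "forward_inv k m" and e: "e 0 = n" "e 1 = r" "e 2 = k" and k: "k < n"
  shows "runs {3, 4} (n * (2 * r + 3)) pivot_com m e
    (\<lambda>m'. forward_inv k m' \<and> m' (9, 0, 0) = entry m' 0 k k \<and> m' (9, 0, 0) \<noteq> 0)"
  unfolding pivot_com_def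
proof (rule runs_Seq_Instr[where k = "n * (2 * r + 3)"])
  \<comment> \<open>Until a pivot is found, the rows tried so far occupy positions \<open>k\<close>
    to \<open>i - 1\<close> and vanish in column \<open>k\<close>, since each exchange moves the
    rejected row to the position of the next candidate. At \<open>i = n\<close> this contradicts
    \<open>nonsingular_system_pivot\<close>.\<close>
  define I where "I i m' \<longleftrightarrow> forward_inv k m' \<and>
      (if m' (9, 0, 0) = 0 then \<forall>q\<in>{k..<i}. entry m' 0 q k = 0
       else m' (9, 0, 0) = entry m' 0 k k)" for i m'
  show "runs {3, 4} (n * (2 * r + 3)) (For 3 (Var 2) (Lit 0) (Var 0)
     (Cond (NumEq (scalar 9) (scalar 10))
       (Seq (swap_com 2 3) (Seq (entry_com 0 2 2) (Instr (NumCopy (scalar 9) (scalar 7)))))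
       Skip)) (nstep (NumConst (scalar 9) 0) e m) e
    (\<lambda>m'. forward_inv k m' \<and> m' (9, 0, 0) = entry m' 0 k k \<and> m' (9, 0, 0) \<noteq> 0)"
  proof (rule runs_For[where W' = "{4}" and k = "2 * r + 3" and I = I], goal_cases)
    case 10
    have "forward_inv k (nstep (NumConst (scalar 9) 0) e m)"
      by (rule forward_inv_frame[OF m]) (use k in auto)
    then show ?case using e by (auto simp: I_def)
  next
    case (11 i m1 e1)
    then have e1: "e1 0 = n" "e1 (Suc 0) = r" "e1 2 = k" "e1 3 = i" and i: "k \<le> i" "i < n"
      using e by auto
    have m1: "forward_inv k m1" and m1': "I i m1" using 11 by (auto simp: I_def)
    then have zero: "m1 (10, 0, 0) = 0" by (simp add: forward_inv_def)
    show ?case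
    proof (rule runs_Cond[where k = "2 * r + 2"], goal_cases)
      case 3
      then have nine: "m1 (9, 0, 0) = 0" using zero by simp
      show ?case
      proof (rule runs_Seq[OF runs_swap, where k' = "2 * r + 2"], goal_cases)
        case (8 m2 e2)
        then have e2: "e2 0 = n" "e2 (Suc 0) = r" "e2 2 = k" "e2 3 = i" using e1 by auto
        have m2: "forward_inv k m2" and entry2: "\<And>q j. entry m2 0 q j = entry m1 0 (swap_idx k i q) j"
          using forward_inv_swap[OF m1, of i m2] 8 e1 i by auto
        show ?case
        proof (rule runs_Seq[OF runs_entry, where k' = 0], goal_cases)
          case (10 m3 e3)
          let ?m = "nstep (NumCopy (scalar 9) (scalar 7)) e3 m3"
          have "forward_inv k ?m"
            by (rule forward_inv_frame[OF m2]) (use k 10 in auto)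
          moreover have "entry ?m 0 = entry m2 0"
            by (intro ext entry_cong) (use 10 in auto)
          moreover have "?m (9, 0, 0) = entry m2 0 k k" using 10 e2 by auto
          moreover have "entry m1 0 q k = 0" if "q \<in> {k..<i}" for q
            using m1' nine that unfolding I_def by auto
          ultimately have "I (Suc i) ?m"
            using i by (auto simp: I_def entry2 swap_idx_def less_Suc_eq)
          then show ?case by (intro runs_Instr) auto
        qed (use e2 k m2 in \<open>auto simp: forward_inv_def\<close>)
      qed (use e1 i in auto)
    next
      case 4
      then have "m1 (9, 0, 0) \<noteq> 0" using zero by simp
      then show ?case using m1' by (intro runs_Skip) (auto simp: I_def)
    qed auto
  next
    case (12 m')
    then have m': "I n m'" using e by simp
    then obtain q where "q \<in> {k..<n}" "entry m' 0 q k \<noteq> 0"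
      using nonsingular_system_pivot[of n k "entry m' 0"] k unfolding I_def forward_inv_def by blast
    with m' show ?case unfolding I_def by (auto split: if_splits)
  qed (use e k in auto)
qed auto

text \<open>The bound adds two entries at \<open>2 * r + 2\<close>, two generator updates at
  \<open>2 * r\<close>, one test, two divisions and two operations on the right-hand side.\<close>

lemma runs_eliminate_row_column:
  assumes e: "e 1 = r" "e 2 = k" "e 3 = i" and ki: "k < n" "i < n" "k \<noteq> i"
    and s: "\<And>j. j < n \<Longrightarrow> m (1, j, 0) = s j" and t: "\<And>i j. i < n \<Longrightarrow> j < n \<Longrightarrow> m (0, i, 0) \<noteq> s j"
    and nz: "m (9, 0, 0) \<noteq> 0"
  shows "runs {4} (8 * r + 9) eliminate_row_column m e (\<lambda>m'. \<forall>b q p. b \<notin> {7, 8, 11} \<longrightarrow> m' (b, q, p) =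
    (if b = 3 \<and> q = i \<and> p < r then m (3, i, p) - entry m 0 k i / m (9, 0, 0) * m (3, k, p)
     else if b = 2 \<and> q = i \<and> p < r then m (2, i, p) - entry m 0 i k / m (9, 0, 0) * m (2, k, p)
     else if b = 4 \<and> q = i \<and> p = 0 then m (4, i, 0) - entry m 0 i k / m (9, 0, 0) * m (4, k, 0)
     else if b = 6 \<and> q = k \<and> p = i \<and> s k = s i then entry m 0 k i else m (b, q, p)))"
  unfolding eliminate_row_column_def
proof (rule runs_Seq[OF runs_entry, where k' = "6 * r + 7"], goal_cases)
  case (10 m1 e1)
  then have e1: "e1 (Suc 0) = r" "e1 2 = k" "e1 3 = i" and u: "m1 (7, 0, 0) = entry m 0 k i"
    and m1: "\<And>b q p. b \<noteq> 7 \<Longrightarrow> b \<noteq> 8 \<Longrightarrow> m1 (b, q, p) = m (b, q, p)" using e by auto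
  show ?case
  proof (rule runs_Seq[where k = 1 and k' = "6 * r + 6" and P = "\<lambda>m'. \<forall>b q p. m' (b, q, p) =
      (if b = 6 \<and> q = k \<and> p = i \<and> s k = s i then m1 (7, 0, 0) else m1 (b, q, p))"], goal_cases)
    case 1
    show ?case
      using e1 ki m1 s by (intro runs_Cond[where k = 0] runs_Instr runs_Skip) auto
  next
    case (2 m2 e2)
    then have e2: "e2 (Suc 0) = r" "e2 2 = k" "e2 3 = i" using e1 by auto
    let ?u = "entry m 0 k i / m (9, 0, 0)"
    have m2: "m2 (7, 0, 0) = entry m 0 k i" "m2 (9, 0, 0) = m (9, 0, 0)"
      "\<And>b q p. b \<notin> {6, 7, 8} \<Longrightarrow> m2 (b, q, p) = m (b, q, p)"
      "\<And>q p. m2 (6, q, p) = (if q = k \<and> p = i \<and> s k = s i then entry m 0 k i else m (6, q, p))"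
      using 2 m1 u by auto
    show ?case
    proof (rule runs_Seq_Instr[where k = "6 * r + 5"], goal_cases)
      case 2
      show ?case
      proof (rule runs_Seq[OF runs_axpy, where k' = "4 * r + 5"], goal_cases)
        case (11 m4 e4)
        then have e4: "e4 (Suc 0) = r" "e4 2 = k" "e4 3 = i" using e2 by auto
        have m4: "m4 (b, q, p) = (if b = 3 \<and> q = i \<and> p < r then m (3, i, p) - ?u * m (3, k, p)
            else if b = 6 \<and> q = k \<and> p = i \<and> s k = s i then entry m 0 k i else m (b, q, p))"
          if "b \<notin> {7, 8, 11}" for b q p
          using 11(1)[rule_format, of b q p] that by (cases "b = 6") (auto simp: m2 e2)
        \<comment> \<open>Row \<open>i\<close> of the right generator has already changed, but the
          entry in row \<open>i\<close> and column \<open>k\<close> involves only row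
          \<open>i\<close> of the left generator, row \<open>k\<close> of the right one and their
          knots.\<close>
        have entry4: "entry m4 0 i k = entry m 0 i k"
          using ki by (intro entry_cong) (auto simp: m4)
        let ?l = "entry m 0 i k / m (9, 0, 0)"
        show ?case
        proof (rule runs_Seq[OF runs_entry, where k' = "2 * r + 3"], goal_cases)
          case (10 m5 e5)
          then have e5: "e5 (Suc 0) = r" "e5 2 = k" "e5 3 = i" using e4 by auto
          have m5: "m5 (7, 0, 0) = entry m 0 i k"
            "\<And>b q p. b \<notin> {7, 8} \<Longrightarrow> m5 (b, q, p) = m4 (b, q, p)"
            using 10 entry4 e4 by auto
          show ?case
          proof (rule runs_Seq_Instr[where k = "2 * r + 2"], goal_cases)
            case 2
            show ?case
            proof (rule runs_Seq[OF runs_axpy, where k' = 2], goal_cases)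
              case (11 m7 e7)
              then have e7: "e7 (Suc 0) = r" "e7 2 = k" "e7 3 = i" using e5 by auto
              have m7: "m7 (b, q, p) =
                 (if b = 2 \<and> q = i \<and> p < r then m (2, i, p) - ?l * m (2, k, p) else m4 (b, q, p))"
                if "b \<notin> {7, 8, 11}" for b q p
                using 11(1)[rule_format, of b q p] that by (auto simp: m5 m4 m2 e5)
              have m7': "m7 (11, 0, 0) = ?l"
                using 11(1)[rule_format, of 11 0 0] by (auto simp: m5 m4 m2 e5)
              show ?case
                using e7 ki by (intro runs_Seq_Instr[where k = 1] runs_Instr) (auto simp: m7 m7' m4)
            qed (use e5 ki in auto)
          qed (use e5 m5 m4 nz in auto)
        qed (use e4 ki m4 s t in auto)
      qed (use e2 ki in auto)
    qed (use e2 m2 nz in auto)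
  qed auto
qed (use assms in auto)

text \<open>All values refer to the memory at the start of step \<open>k\<close>. A closed form is
  possible because the generator rows of index \<open>k\<close> stay fixed and the entries for
  \<open>q\<close> do not depend on other processed rows.\<close>

definition eliminated :: "mem \<Rightarrow> nat \<Rightarrow> nat \<Rightarrow> cell \<Rightarrow> complex" where
  "eliminated m k i = (\<lambda>(b, q, p).
     if b = 3 \<and> k < q \<and> q < i \<and> p < r
       then m (3, q, p) - entry m 0 k q / entry m 0 k k * m (3, k, p)
     else if b = 2 \<and> k < q \<and> q < i \<and> p < r
       then m (2, q, p) - entry m 0 q k / entry m 0 k k * m (2, k, p)
     else if b = 4 \<and> k < q \<and> q < i \<and> p = 0
       then m (4, q, 0) - entry m 0 q k / entry m 0 k k * m (4, k, 0)
     else if b = 6 \<and> q = k \<and> k < p \<and> p < i \<and> s k = s p then entry m 0 k p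
     else m (b, q, p))"

lemma forward_inv_eliminated:
  assumes m: "forward_inv k m" and k: "k < n" and piv: "entry m 0 k k \<noteq> 0"
    and m': "\<And>b q p. b \<notin> {7, 8, 11} \<Longrightarrow> m' (b, q, p) = eliminated m k n (b, q, p)"
  shows "forward_inv (Suc k) m'"
proof -
  have s: "m (Suc 0, j, 0) = s j" if "j < n" for j
    using m that unfolding forward_inv_def by simp
  have t: "m (0, i, 0) \<noteq> s j" if "i < n" "j < n" for i j
    using m that unfolding forward_inv_def by blast
  have dot: "(\<Sum>p<r. m (2, i, p) * m (3, j, p)) = (m (0, i, 0) - s j) * entry m 0 i j"
    if "i < n" "j < n" for i j
    using s[of j] t[of i j] that by (simp add: entry_def)
  have entry': "entry m' 0 i j = entry m 0 i j - entry m 0 i k * entry m 0 k j / entry m 0 k k"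
    if "i \<in> {Suc k..<n}" "j \<in> {Suc k..<n}" for i j
  proof -
    have "entry m' 0 i j = (\<Sum>p<r. (m (2, i, p) - entry m 0 i k / entry m 0 k k * m (2, k, p)) *
      (m (3, j, p) - entry m 0 k j / entry m 0 k k * m (3, k, p))) / (m (0, i, 0) - s j)"
      unfolding entry_def[of m'] using that s
      by (intro arg_cong2[where f = "(/)"] sum.cong) (auto simp: m' eliminated_def)
    also have "\<dots> = (\<Sum>p<r. m (2, i, p) * m (3, j, p)) / (m (0, i, 0) - s j)
      - entry m 0 i k * entry m 0 k j / entry m 0 k k"
      by (rule cauchy_like_schur_complement) (use that k piv dot t in auto)
    finally show ?thesis using that by (simp add: s entry_def[of m 0 i j])
  qed
  have "nonsingular_system n k (entry m 0) (\<lambda>i. m (4, i, 0)) x"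
    using m by (simp add: forward_inv_def)
  from nonsingular_system_eliminate[OF this k piv]
  have "nonsingular_system n (Suc k) (entry m' 0) (\<lambda>i. m' (4, i, 0)) x"
    by (rule nonsingular_system_cong) (auto simp: entry' m' eliminated_def)
  moreover have "history (Suc k) m' (\<lambda>j p. m' (3, j, p))"
    unfolding history.simps
  \<comment> \<open>The witnesses are the right generator before the step and
    \<open>entry m 0 k\<close>, which is row \<open>k\<close> of the triangular factor.\<close>
  proof (intro exI conjI)
    show "history k m' (\<lambda>j p. m (3, j, p))"
      by (rule history_cong[where m = m and h = "\<lambda>j p. m (3, j, p)"])
        (use m k in \<open>auto simp: m' eliminated_def forward_inv_def\<close>)
    show "\<forall>j<n. (\<Sum>p<r. m' (2, k, p) * m (3, j, p)) = (m' (0, k, 0) - s j) * entry m 0 k j"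
      using dot k by (auto simp: m' eliminated_def)
    show "(\<Sum>j = k..<n. entry m 0 k j * x j) = m' (4, k, 0)"
      using m k by (auto simp: forward_inv_def nonsingular_system_def m' eliminated_def)
  qed (use piv k in \<open>auto simp: m' eliminated_def\<close>)
  ultimately show ?thesis
    using m k unfolding forward_inv_def by (auto simp: m' eliminated_def)
qed

lemma runs_forward:
  assumes m: "forward_inv k m" and e: "e 0 = n" "e 1 = r" "e 2 = k" and k: "k < n"
  shows "runs {3, 4} (n * (10 * r + 12)) forward_com m e (forward_inv (Suc k))"
  unfolding forward_com_def
proof (rule runs_Seq[OF runs_pivot[OF assms], where k' = "n * (8 * r + 9)"], goal_cases)
  case (1 m1 e1)
  then have e1: "e1 0 = n" "e1 (Suc 0) = r" "e1 2 = k" and m1: "forward_inv k m1"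
    and piv: "m1 (9, 0, 0) = entry m1 0 k k" "entry m1 0 k k \<noteq> 0" using e by auto
  show ?case
  proof (rule runs_For[where W' = "{4}" and k = "8 * r + 9" and I = "\<lambda>i m'. \<forall>b q p.
        b \<notin> {7, 8, 11} \<longrightarrow> m' (b, q, p) = eliminated m1 k i (b, q, p)"], goal_cases)
    case 10
    then show ?case using e1 by (auto simp: eliminated_def)
  next
    case (11 i m2 e2)
    then have e2: "e2 0 = n" "e2 (Suc 0) = r" "e2 2 = k" "e2 3 = i" and i: "k < i" "i < n"
      using e1 by auto
    have m2: "m2 (b, q, p) = eliminated m1 k i (b, q, p)" if "b \<notin> {7, 8, 11}" for b q p
      using 11 that by blast
    have "entry m2 0 k i = entry m1 0 k i" "entry m2 0 i k = entry m1 0 i k"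
      using i by (auto intro!: entry_cong simp: m2 eliminated_def)
    moreover have "runs {4} (8 * r + 9) eliminate_row_column m2 e2 (\<lambda>m'. \<forall>b q p. b \<notin> {7, 8, 11} \<longrightarrow> m' (b, q, p) =
      (if b = 3 \<and> q = i \<and> p < r then m2 (3, i, p) - entry m2 0 k i / m2 (9, 0, 0) * m2 (3, k, p)
       else if b = 2 \<and> q = i \<and> p < r then m2 (2, i, p) - entry m2 0 i k / m2 (9, 0, 0) * m2 (2, k, p)
       else if b = 4 \<and> q = i \<and> p = 0 then m2 (4, i, 0) - entry m2 0 i k / m2 (9, 0, 0) * m2 (4, k, 0)
       else if b = 6 \<and> q = k \<and> p = i \<and> s k = s i then entry m2 0 k i else m2 (b, q, p)))"
      using e2 i k m1 piv
      by (intro runs_eliminate_row_column) (auto simp: m2 eliminated_def forward_inv_def)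
    ultimately show ?case
      using i piv by (elim runs_mono) (auto simp: m2 eliminated_def less_Suc_eq)
  next
    case (12 m')
    then show ?case
      using forward_inv_eliminated[OF m1 k piv(2)] e1 by auto
  qed (use e1 k in auto)
qed (auto simp: algebra_simps)

subsection \<open>Backward phase\<close>

text \<open>The equations of the triangular system are part of \<open>history\<close>, so only the
  known components of \<open>x\<close> are added.\<close>

definition backward_inv :: "nat \<Rightarrow> mem \<Rightarrow> bool" where
  "backward_inv k m \<longleftrightarrow> (\<forall>j<n. m (1, j, 0) = s j) \<and> (\<forall>i<n. \<forall>j<n. m (0, i, 0) \<noteq> s j) \<and>
     history k m (\<lambda>j p. m (3, j, p)) \<and> (\<forall>j\<in>{k..<n}. m (5, j, 0) = x j)"

lemma runs_restore_row:
  assumes e: "e 1 = r" "e 2 = k" "e 3 = i" and ki: "k < n" "i < n" "k \<noteq> i"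
    and s: "\<And>j. j < n \<Longrightarrow> m (1, j, 0) = s j" and nz: "m (9, 0, 0) \<noteq> 0"
    and u: "s k = s i \<Longrightarrow> m (6, k, i) = u" "s k \<noteq> s i \<Longrightarrow> entry m 1 k i = u"
  shows "runs {4} (4 * r + 6) restore_row m e (\<lambda>m'. \<forall>b q p. b \<notin> {7, 8, 11} \<longrightarrow> m' (b, q, p) =
    (if b = 3 \<and> q = i \<and> p < r then m (3, i, p) + u / m (9, 0, 0) * m (3, k, p)
     else if b = 12 \<and> q = 0 \<and> p = 0 then m (12, 0, 0) - u * m (5, i, 0) else m (b, q, p)))"
  unfolding restore_row_def
proof (rule runs_Seq[where k = "2 * r + 3" and k' = "2 * r + 3" and
      P = "\<lambda>m'. m' (7, 0, 0) = u \<and> (\<forall>b q p. b \<notin> {7, 8} \<longrightarrow> m' (b, q, p) = m (b, q, p))"], goal_cases)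
  case 1
  show ?case
  proof (rule runs_Cond[where k = "2 * r + 2"], goal_cases)
    case 3
    then show ?case using e ki s u by (intro runs_Instr) auto
  next
    case 4
    have "runs {4} (2 * r + 2) (entry_com 1 2 3) m e
      (\<lambda>m'. m' (7, 0, 0) = entry m 1 (e 2) (e 3) \<and>
        (\<forall>a i j. a \<noteq> 7 \<longrightarrow> a \<noteq> 8 \<longrightarrow> m' (a, i, j) = m (a, i, j)))"
      by (rule runs_entry) (use 4 e ki s in auto)
    then show ?case by (rule runs_mono) (use 4 e ki s u in auto)
  qed (use e ki in auto)
next
  case (2 m1 e1)
  then have e1: "e1 (Suc 0) = r" "e1 2 = k" "e1 3 = i" and m1: "m1 (7, 0, 0) = u"
    "\<And>b q p. b \<notin> {7, 8} \<Longrightarrow> m1 (b, q, p) = m (b, q, p)" using e by auto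
  let ?m = "nstep (NumArith Divide (scalar 11) (scalar 7) (scalar 9)) e1
    (nstep (NumArith Minus (scalar 12) (scalar 12) (scalar 8)) e1
    (nstep (NumArith Times (scalar 8) (scalar 7) (Ref 5 (Var 3) (Lit 0))) e1 m1))"
  have "runs {4} (2 * r) (axpy_com Plus 3 3 2) ?m e1
    (\<lambda>m'. \<forall>b q p. b \<noteq> 8 \<longrightarrow> m' (b, q, p) = (if b = 3 \<and> q = e1 3 \<and> p < r
      then arith_val Plus (?m (3, e1 3, p)) (?m (11, 0, 0) * ?m (3, e1 2, p)) else ?m (b, q, p)))"
    by (rule runs_axpy) (use e1 ki in auto)
  then have "runs {4} (2 * r) (axpy_com Plus 3 3 2) ?m e1
    (\<lambda>m'. \<forall>b q p. b \<notin> {7, 8, 11} \<longrightarrow> m' (b, q, p) =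
    (if b = 3 \<and> q = i \<and> p < r then m (3, i, p) + u / m (9, 0, 0) * m (3, k, p)
     else if b = 12 \<and> q = 0 \<and> p = 0 then m (12, 0, 0) - u * m (5, i, 0) else m (b, q, p)))"
    by (rule runs_mono) (use e1 m1 in auto)
  then show ?case
    using e1 ki m1 nz
    by (intro runs_Seq_Instr[where k = "2 * r + 2"] runs_Seq_Instr[where k = "2 * r + 1"]
        runs_Seq_Instr[where k = "2 * r"]) auto
qed auto

text \<open>The outermost layer of \<open>history (Suc k)\<close> supplies row \<open>k\<close> of
  the triangular factor as \<open>a\<close> and the right generator before step \<open>k\<close> as
  \<open>h\<close>. The loop restores \<open>h\<close> while subtracting the known terms of equation
  \<open>k\<close>.\<close>

lemma runs_backward:
  assumes m: "backward_inv (Suc k) m" and e: "e 0 = n" "e 1 = r" "e 2 = k" and k: "k < n"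
  shows "runs {3, 4} (n * (4 * r + 6) + 2 * r + 3) backward_com m e (backward_inv k)"
proof -
  have s: "m (1, j, 0) = s j" and t: "m (0, i, 0) \<noteq> s j" if "i < n" "j < n" for i j
    using m that unfolding backward_inv_def by auto
  have x: "m (5, j, 0) = x j" if "k < j" "j < n" for j
    using m that unfolding backward_inv_def by auto
  have "history (Suc k) m (\<lambda>j p. m (3, j, p))" using m unfolding backward_inv_def by blast
  then obtain h a where h: "history k m h"
    and dot: "\<And>j. j < n \<Longrightarrow> (\<Sum>p<r. m (2, k, p) * h j p) = (m (0, k, 0) - s j) * a j"
    and piv: "a k \<noteq> 0"
    and h': "\<And>j p. j < n \<Longrightarrow> p < r \<Longrightarrow> m (3, j, p) = (if k < j then h j p - a j / a k * h k p else h j p)"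
    and stored: "\<And>j. j < n \<Longrightarrow> k < j \<Longrightarrow> s j = s k \<Longrightarrow> m (6, k, j) = a j"
    and row: "(\<Sum>j\<in>{k..<n}. a j * x j) = m (4, k, 0)"
    unfolding history.simps by blast
  \<comment> \<open>Row \<open>k\<close> of the right generator is untouched by its own step, so the
    pivot can be recomputed instead of stored.\<close>
  have piv': "entry m 0 k k = a k"
  proof -
    have "(\<Sum>p<r. m (2, k, p) * m (3, k, p)) = (\<Sum>p<r. m (2, k, p) * h k p)"
      using k by (intro sum.cong) (auto simp: h')
    then show ?thesis using dot[OF k] s[OF k k] t[OF k k] by (simp add: entry_def)
  qed
  show ?thesis
    unfolding backward_com_def
  proof (rule runs_Seq[where k = "2 * r + 2" and k' = "n * (4 * r + 6) + 1" and
        P = "\<lambda>m'. m' (7, 0, 0) = a k \<and> (\<forall>b q p. b \<notin> {7, 8} \<longrightarrow> m' (b, q, p) = m (b, q, p))"], goal_cases)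
    case 1
    have "runs {4} (2 * r + 2) (entry_com 0 2 2) m e
      (\<lambda>m'. m' (7, 0, 0) = entry m 0 (e 2) (e 2) \<and>
        (\<forall>a i j. a \<noteq> 7 \<longrightarrow> a \<noteq> 8 \<longrightarrow> m' (a, i, j) = m (a, i, j)))"
      by (rule runs_entry) (use e k s t in auto)
    then show ?case by (rule runs_mono) (use e piv' in auto)
  next
    case (2 m1 e1)
    then have e1: "e1 0 = n" "e1 (Suc 0) = r" "e1 2 = k" and m1: "m1 (7, 0, 0) = a k"
      "\<And>b q p. b \<notin> {7, 8} \<Longrightarrow> m1 (b, q, p) = m (b, q, p)" using e by auto
    let ?m = "nstep (NumCopy (scalar 12) (Ref 4 (Var 2) (Lit 0))) e1
      (nstep (NumCopy (scalar 9) (scalar 7)) e1 m1)"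
    \<comment> \<open>Rows strictly between \<open>k\<close> and \<open>i\<close> are back at
      \<open>h\<close>; rows from \<open>i\<close> on are still updated, as
      \<open>updated_generator_entry\<close> requires.\<close>
    define I where "I i m' \<longleftrightarrow> (\<forall>b q p. b \<notin> {7, 8, 11} \<longrightarrow> m' (b, q, p) =
      (if b = 9 \<and> q = 0 \<and> p = 0 then a k
       else if b = 12 \<and> q = 0 \<and> p = 0 then m (4, k, 0) - (\<Sum>j\<in>{Suc k..<i}. a j * x j)
       else if b = 3 \<and> k < q \<and> q < i \<and> p < r then h q p else m (b, q, p)))" for i m'
    have loop: "runs {3, 4} (n * (4 * r + 6)) (For 3 (Var 2) (Lit 1) (Var 0) restore_row) ?m e1 (I n)"
    proof (rule runs_For[where W' = "{4}" and k = "4 * r + 6" and I = I], goal_cases)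
      case 10
      then show ?case using e1 m1 by (auto simp: I_def)
    next
      case (11 i m2 e2)
      then have e2: "e2 0 = n" "e2 (Suc 0) = r" "e2 2 = k" "e2 3 = i" and i: "k < i" "i < n"
        using e1 by auto
      have m2: "m2 (b, q, p) =
        (if b = 9 \<and> q = 0 \<and> p = 0 then a k
         else if b = 12 \<and> q = 0 \<and> p = 0 then m (4, k, 0) - (\<Sum>j\<in>{Suc k..<i}. a j * x j)
         else if b = 3 \<and> k < q \<and> q < i \<and> p < r then h q p else m (b, q, p))"
        if "b \<notin> {7, 8, 11}" for b q p
        using 11 that unfolding I_def by blast
      have "(\<Sum>p<r. m2 (2, k, p) * m2 (3, i, p)) = (\<Sum>p<r. m (2, k, p) * (h i p - a i / a k * h k p))"
        using i k by (intro sum.cong) (auto simp: m2 h')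
      also have "\<dots> = (s k - s i) * a i"
        using dot i k piv by (intro updated_generator_entry) auto
      finally have u: "entry m2 1 k i = a i" if "s k \<noteq> s i"
        using that i k s by (simp add: entry_def m2)
      have "runs {4} (4 * r + 6) restore_row m2 e2 (\<lambda>m'. \<forall>b q p. b \<notin> {7, 8, 11} \<longrightarrow> m' (b, q, p) =
        (if b = 3 \<and> q = i \<and> p < r then m2 (3, i, p) + a i / m2 (9, 0, 0) * m2 (3, k, p)
         else if b = 12 \<and> q = 0 \<and> p = 0 then m2 (12, 0, 0) - a i * m2 (5, i, 0) else m2 (b, q, p)))"
        using e2 i k s u piv stored by (intro runs_restore_row) (auto simp: m2)
      then show ?case
        by (rule runs_mono) (use i k x h' in \<open>auto simp: I_def m2 less_Suc_eq\<close>)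
    qed (use e1 k in auto)
    show ?case
    proof (rule runs_Seq_Instr[where k = "n * (4 * r + 6) + 1"], goal_cases)
      case 2
      show ?case
      proof (rule runs_Seq_Instr[where k = "n * (4 * r + 6) + 1"], goal_cases)
        case 2
        show ?case
        proof (rule runs_Seq[OF loop, where k' = 1], goal_cases)
          case (1 m2 e2)
          then have e2: "e2 2 = k" using e1 by auto
          have m2: "m2 (b, q, p) =
            (if b = 9 \<and> q = 0 \<and> p = 0 then a k
             else if b = 12 \<and> q = 0 \<and> p = 0 then m (4, k, 0) - (\<Sum>j\<in>{Suc k..<n}. a j * x j)
             else if b = 3 \<and> k < q \<and> q < n \<and> p < r then h q p else m (b, q, p))"
            if "b \<notin> {7, 8, 11}" for b q p
            using 1 that unfolding I_def by blast
          let ?m' = "nstep (NumArith Divide (Ref 5 (Var 2) (Lit 0)) (scalar 12) (scalar 9)) e2 m2"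
          have "m (4, k, 0) - (\<Sum>j\<in>{Suc k..<n}. a j * x j) = a k * x k"
            unfolding row[symmetric] using k by (simp add: sum.atLeast_Suc_lessThan)
          then have "?m' (5, j, 0) = x j" if "j \<in> {k..<n}" for j
            using that e2 piv x by (auto simp: m2)
          moreover have "history k ?m' (\<lambda>j p. ?m' (3, j, p))"
            by (rule history_cong[OF h]) (use k h' in \<open>auto simp: m2\<close>)
          ultimately have "backward_inv k ?m'"
            using s t k e2 unfolding backward_inv_def by (auto simp: m2)
          then show ?case
            using e2 piv k by (intro runs_Instr) (auto simp: m2)
        qed auto
      qed (use e1 k in auto)
    qed (use e1 in auto)
  qed auto
qed

section \<open>Assembly of conjugation, forward phase and backward phase\<close>

lemma runs_gko:
  assumes e: "e 0 = n" "e 1 = r"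
    and s: "\<And>j. j < n \<Longrightarrow> m (1, j, 0) = s j" and t: "\<And>i j. i < n \<Longrightarrow> j < n \<Longrightarrow> m (0, i, 0) \<noteq> s j"
    and sys: "nonsingular_system n 0
      (\<lambda>i j. (\<Sum>p<r. m (2, i, p) * cnj (m (3, j, p))) / (m (0, i, 0) - s j)) (\<lambda>i. m (4, i, 0)) x"
  shows "runs {2, 3, 4, 5} (n * r + n * (n * (10 * r + 12)) + n * (n * (4 * r + 6) + 2 * r + 3))
    gko_com m e (\<lambda>m'. \<forall>j<n. m' (5, j, 0) = x j)"
proof -
  \<comment> \<open>Progress of both nested loops: a finished row gives \<open>J i r\<close>, which
    agrees with \<open>J (Suc i) 0\<close>.\<close>
  define J where "J i l m' \<longleftrightarrow> (\<forall>b q p. m' (b, q, p) =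
    (if b = 3 \<and> (q < i \<and> p < r \<or> q = i \<and> p < l) then cnj (m (b, q, p)) else m (b, q, p)))" for i l m'
  have conj: "runs {2, 3, 4, 5} (n * r) (For 3 (Lit 0) (Lit 0) (Var 0) (For 4 (Lit 0) (Lit 0) (Var 1)
       (Instr (NumConj (Ref 3 (Var 3) (Var 4)) (Ref 3 (Var 3) (Var 4)))))) m e (J n 0)"
  proof (rule runs_For[where W' = "{4}" and k = r and I = "\<lambda>i. J i 0"], goal_cases)
    case (11 i m1 e1)
    then have e1: "e1 0 = n" "e1 (Suc 0) = r" "e1 3 = i" "i < n" and m1: "J i 0 m1" using e by auto
    show ?case
    proof (rule runs_For[where W' = "{}" and k = 1 and I = "J i"], goal_cases)
      case (11 l m2 e2)
      then have e2: "e2 3 = i" "e2 4 = l" "l < r" using e1 by auto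
      then show ?case using 11 e1 by (intro runs_Instr) (auto simp: J_def)
    qed (use e1 m1 in \<open>auto simp: J_def\<close>)
  qed (use e in \<open>auto simp: J_def\<close>)
  let ?F = "n * (n * (10 * r + 12))" and ?B = "n * (n * (4 * r + 6) + 2 * r + 3)"
  show ?thesis
    unfolding gko_com_def
  proof (rule runs_Seq[OF conj, where k' = "?F + ?B"], goal_cases)
    case (1 m1 e1)
    then have e1: "e1 0 = n" "e1 (Suc 0) = r" using e by auto
    have m1: "m1 (b, q, p) = (if b = 3 \<and> q < n \<and> p < r then cnj (m (b, q, p)) else m (b, q, p))" for b q p
      using 1 unfolding J_def by auto
    let ?m = "nstep (NumConst (scalar 10) 0) e1 m1"
    from sys have "nonsingular_system n 0 (entry ?m 0) (\<lambda>i. ?m (4, i, 0)) x"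
      by (rule nonsingular_system_cong) (auto simp: entry_def m1 s[simplified])
    then have init: "forward_inv 0 ?m"
      unfolding forward_inv_def using s t by (auto simp: m1)
    show ?case
    proof (rule runs_Seq_Instr[where k = "?F + ?B"], goal_cases)
      case 2
      show ?case
      proof (rule runs_Seq[where k = ?F and k' = ?B and P = "forward_inv n"], goal_cases)
        case 1
        show ?case
        proof (rule runs_For[where W' = "{3, 4}" and k = "n * (10 * r + 12)" and I = forward_inv], goal_cases)
          case (11 i m2 e2)
          then show ?case using e1 by (intro runs_forward) auto
        qed (use e1 init in auto)
      next
        case (2 m2 e2)
        then have e2: "e2 0 = n" "e2 (Suc 0) = r" using e1 by auto
        \<comment> \<open>At step \<open>n\<close> no component of \<open>x\<close> is claimed yet,
          so the final state of the forward phase qualifies.\<close>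
        from 2 have "backward_inv n m2" by (auto simp: forward_inv_def backward_inv_def)
        then show ?case
        proof (intro runs_For[where W' = "{2, 3, 4}" and k = "n * (4 * r + 6) + 2 * r + 3"
              and I = "\<lambda>i. backward_inv (n - i)"], goal_cases)
          case (11 i m3 e3)
          then have e3: "e3 0 = n" "e3 (Suc 0) = r" "e3 5 = i" and i: "i < n" using e2 by auto
          have "runs {3, 4} (n * (4 * r + 6) + 2 * r + 3) backward_com m3 (e3(2 := n - Suc i))
            (backward_inv (n - Suc i))"
            by (rule runs_backward) (use e3 i 11 in \<open>auto simp: Suc_diff_Suc\<close>)
          then have "runs {2, 3, 4} (n * (4 * r + 6) + 2 * r + 3) backward_com m3 (e3(2 := n - Suc i))
            (backward_inv (n - Suc i))"
            by (rule runs_mono) auto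
          then show ?case
            using e3 by (intro runs_Seq_IdxMinus) auto
        qed (use e2 in \<open>auto simp: backward_inv_def\<close>)
      qed auto
    qed auto
  qed auto
qed

end

section \<open>Resources and the main theorem\<close>

text \<open>\<open>4 * n\<close> counts knots, right-hand side and solution;
  \<open>3 * (n * r)\<close> counts the two generators and, by the multiplicity bound, array 6; 6
  counts the scalars.\<close>

lemma card_allowed:
  assumes "\<And>i. i < n \<Longrightarrow> card {j. j < n \<and> s j = s i} \<le> r"
  shows "finite (Collect (allowed n r s))" "card (Collect (allowed n r s)) \<le> 4 * n + 3 * (n * r) + 6"
proof -
  define P1 P2 P3 P4 where "P1 = {0, 1, 4, 5::nat} \<times> {..<n} \<times> {0::nat}"
    and "P2 = {2, 3::nat} \<times> {..<n} \<times> {..<r}"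
    and "P3 = {6::nat} \<times> (SIGMA i:{..<n}. {j. j < n \<and> s j = s i})"
    and "P4 = {7, 8, 9, 10, 11, 12::nat} \<times> {0::nat} \<times> {0::nat}"
  note defs = P1_def P2_def P3_def P4_def
  have eq: "Collect (allowed n r s) \<subseteq> P1 \<union> P2 \<union> P3 \<union> P4"
  proof
    fix c assume c: "c \<in> Collect (allowed n r s)"
    obtain a i j where "c = (a, i, j)" by (cases c)
    with c have "allowed n r s (a, i, j)" by (simp only: mem_Collect_eq)
    then consider "a \<in> {0, 1, 4, 5}" "i < n" "j = 0" | "a \<in> {2, 3}" "i < n" "j < r"
      | "a = 6" "i < n" "j < n" "s j = s i" | "a \<in> {7, 8, 9, 10, 11, 12}" "i = 0" "j = 0"
      unfolding allowed.simps by metis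
    then show "c \<in> P1 \<union> P2 \<union> P3 \<union> P4"
      unfolding \<open>c = _\<close> defs by cases blast+
  qed
  have fin: "finite P1" "finite P2" "finite P3" "finite P4"
    unfolding defs by simp_all
  have "(\<Sum>i<n. card {j. j < n \<and> s j = s i}) \<le> (\<Sum>i<n. r)"
    using assms by (intro sum_mono) auto
  then have "card P3 \<le> n * r" by (simp add: P3_def card_cartesian_product card_SigmaI)
  moreover have "card P1 = 4 * n" "card P2 = 2 * (n * r)" "card P4 = 6"
    unfolding defs by (simp_all add: card_cartesian_product)
  moreover have "card (P1 \<union> P2 \<union> P3 \<union> P4) \<le> card P1 + card P2 + card P3 + card P4"
    using card_Un_le[of P1 P2] card_Un_le[of "P1 \<union> P2" P3] card_Un_le[of "P1 \<union> P2 \<union> P3" P4]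
    by linarith
  moreover have "card (Collect (allowed n r s)) \<le> card (P1 \<union> P2 \<union> P3 \<union> P4)"
    using fin by (intro card_mono eq) auto
  ultimately show "card (Collect (allowed n r s)) \<le> 4 * n + 3 * (n * r) + 6" by linarith
  show "finite (Collect (allowed n r s))" using fin by (intro finite_subset[OF eq]) auto
qed

section \<open>From invertible matrices to systems with trivial kernel\<close>

lemma nonsingular_system_invertible:
  assumes C: "C \<in> carrier_mat n n" "invertible_mat C" and b: "b \<in> carrier_vec n"
  obtains x where "x \<in> carrier_vec n" "C *\<^sub>v x = b"
    "nonsingular_system n 0 (\<lambda>i j. C $$ (i, j)) (($) b) (($) x)"
proof -
  from C obtain D where CD: "C * D = 1\<^sub>m n" "D * C = 1\<^sub>m (dim_row D)"
    unfolding invertible_mat_def inverts_mat_def by auto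
  have D: "D \<in> carrier_mat n n"
    using arg_cong[OF CD(1), of dim_col] arg_cong[OF CD(2), of dim_col] C(1) by auto
  have mult: "(C *\<^sub>v v) $ i = (\<Sum>j\<in>{0..<n}. C $$ (i, j) * v $ j)"
    if "v \<in> carrier_vec n" "i < n" for v i
    using that C(1) by (auto simp: scalar_prod_def intro!: sum.cong)
  define x where "x = D *\<^sub>v b"
  have x: "x \<in> carrier_vec n" "C *\<^sub>v x = b"
    using C(1) D b CD(1) by (auto simp: x_def assoc_mult_mat_vec[symmetric])
  have "nonsingular_system n 0 (\<lambda>i j. C $$ (i, j)) (($) b) (($) x)"
    unfolding nonsingular_system_def
  proof (intro conjI ballI allI impI)
    fix i assume "i \<in> {0..<n}"
    then show "(\<Sum>j\<in>{0..<n}. C $$ (i, j) * x $ j) = b $ i" using mult[OF x(1), of i] x(2) by simp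
  next
    fix v j assume v: "\<forall>i\<in>{0..<n}. (\<Sum>j\<in>{0..<n}. C $$ (i, j) * v j) = 0" and j: "j \<in> {0..<n}"
    have "C *\<^sub>v vec n v = 0\<^sub>v n"
      using v C(1) by (intro eq_vecI) (auto simp: mult simp del: index_mult_mat_vec)
    then have "D *\<^sub>v (C *\<^sub>v vec n v) = 0\<^sub>v n" using D by auto
    then have "vec n v = 0\<^sub>v n" using C(1) D CD(2) by (simp add: assoc_mult_mat_vec[symmetric])
    from arg_cong[OF this, of "\<lambda>w. w $ j"] j show "v j = 0" by simp
  qed
  with x that show thesis by blast
qed

lemma index_cauchy_like:
  assumes "G \<in> carrier_mat n r" "H \<in> carrier_mat n r" "i < n" "j < n"
  shows "cauchy_like n t s G H $$ (i, j) =
    (\<Sum>p<r. G $$ (i, p) * cnj (H $$ (j, p))) / (t $ i - s $ j)"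
proof -
  have "(G * mat_adjoint H) $$ (i, j) = (\<Sum>p\<in>{0..<r}. G $$ (i, p) * cnj (H $$ (j, p)))"
    using assms by (auto simp: mat_adjoint_def scalar_prod_def mat_of_rows_def intro!: sum.cong)
  then show ?thesis using assms(3,4) by (simp add: cauchy_like_def atLeast0LessThan)
qed

theorem mainTheorem1:
  shows "\<exists>(K::real) (M::real) (prog::com). K > 0 \<and>
    (\<forall>(n::nat) (r::nat) (t::complex vec) (s::complex vec) (G::complex mat) (H::complex mat)
        (b::complex vec) (\<sigma>::state).
      n > 0 \<longrightarrow> r > 0 \<longrightarrow>
      t \<in> carrier_vec n \<longrightarrow> s \<in> carrier_vec n \<longrightarrow>
      G \<in> carrier_mat n r \<longrightarrow> H \<in> carrier_mat n r \<longrightarrow> b \<in> carrier_vec n \<longrightarrow>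
      (\<forall>i<n. \<forall>j<n. t $ i \<noteq> s $ j) \<longrightarrow>
      invertible_mat (cauchy_like n t s G H) \<longrightarrow>
      initial n r t s G H b \<sigma> \<longrightarrow>
      (\<exists>\<tau>. exec prog \<sigma> \<tau> \<and>
        cauchy_like n t s G H *\<^sub>v result n \<tau> = b \<and>
        real (ops \<tau>) \<le> K * real r * real n ^ 2 \<and>
        finite (used \<tau>) \<and> real (card (used \<tau>)) \<le> K * real r * real n \<and>
        real (peak \<tau>) \<le> M * real (n + r)))"
proof (rule exI[of _ 40], rule exI[of _ 1], rule exI[of _ gko_com], intro conjI allI impI)
  fix n r :: nat and t s :: "complex vec" and G H :: "complex mat" and b :: "complex vec"
    and \<sigma> :: state
  assume pos: "n > 0" "r > 0" and GH: "G \<in> carrier_mat n r" "H \<in> carrier_mat n r"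
    and b: "b \<in> carrier_vec n" and ts: "\<forall>i<n. \<forall>j<n. t $ i \<noteq> s $ j"
    and inv: "invertible_mat (cauchy_like n t s G H)" and init: "initial n r t s G H b \<sigma>"
  let ?C = "cauchy_like n t s G H"
  have "?C \<in> carrier_mat n n" by (simp add: cauchy_like_def)
  from nonsingular_system_invertible[OF this inv b] obtain x where
    x: "x \<in> carrier_vec n" "?C *\<^sub>v x = b" and
    sys: "nonsingular_system n 0 (\<lambda>i j. ?C $$ (i, j)) (($) b) (($) x)" by blast
  interpret gko n r "($) s" "($) x" .
  have "card {j. j < n \<and> s $ j = c} \<le> r" for c
  proof (rule card_coincidences[where t = "($) t" and G = "\<lambda>i p. G $$ (i, p)"
        and H = "\<lambda>j p. cnj (H $$ (j, p))"])
    fix v j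
    assume v: "\<And>i. i < n \<Longrightarrow>
      (\<Sum>j<n. (\<Sum>p<r. G $$ (i, p) * cnj (H $$ (j, p))) / (t $ i - s $ j) * v j) = 0" and j: "j < n"
    have "(\<Sum>j\<in>{0..<n}. ?C $$ (i, j) * v j) = 0" if "i < n" for i
      using v[OF that] GH that by (simp add: index_cauchy_like atLeast0LessThan)
    with j show "v j = 0"
      by (rule_tac nonsingular_system_inj[OF sys, of v j]) simp_all
  qed
  note allowed = card_allowed[OF this]
  \<comment> \<open>The constant 12 consists of six complex scalars and six index variables.\<close>
  have L: "finite L" "card L \<le> 4 * n + 3 * (n * r) + 12"
  proof -
    have "card (Num ` Collect (allowed n r (($) s))) \<le> card (Collect (allowed n r (($) s)))"
      "card ((\<lambda>a. Idx (a, 0, 0)) ` {..<6::nat}) \<le> 6"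
      using card_image_le[of "Collect (allowed n r (($) s))" Num] allowed(1)
        card_image_le[of "{..<6::nat}" "\<lambda>a. Idx (a, 0, 0)"] by auto
    with allowed show "finite L" "card L \<le> 4 * n + 3 * (n * r) + 12"
      unfolding L_def using card_Un_le[of "Num ` Collect (allowed n r (($) s))"
        "(\<lambda>a. Idx (a, 0, 0)) ` {..<6::nat}"] by auto
  qed
  have input: "used \<sigma> \<subseteq> L"
    using init by (auto simp: initial_def input_locs_def L_def)
  have runs: "runs {2, 3, 4, 5} (n * r + n * (n * (10 * r + 12)) + n * (n * (4 * r + 6) + 2 * r + 3))
    gko_com (num \<sigma>) (\<lambda>a. idx \<sigma> (a, 0, 0)) (\<lambda>m'. \<forall>j<n. m' (5, j, 0) = x $ j)"
  proof (rule runs_gko)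
    show "nonsingular_system n 0 (\<lambda>i j. (\<Sum>p<r. num \<sigma> (2, i, p) * cnj (num \<sigma> (3, j, p))) /
      (num \<sigma> (0, i, 0) - s $ j)) (\<lambda>i. num \<sigma> (4, i, 0)) (($) x)"
      using sys
      by (rule nonsingular_system_cong) (use init GH in \<open>auto simp: initial_def index_cauchy_like\<close>)
  qed (use init ts in \<open>auto simp: initial_def\<close>)
  then obtain \<tau> where \<tau>: "exec gko_com \<sigma> \<tau>"
    "ops \<tau> \<le> ops \<sigma> + (n * r + n * (n * (10 * r + 12)) + n * (n * (4 * r + 6) + 2 * r + 3))"
    "used \<tau> \<subseteq> used \<sigma> \<union> L" "peak \<tau> \<le> max (peak \<sigma>) (max n r)"
    "\<forall>j<n. num \<tau> (5, j, 0) = x $ j"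
    unfolding runs_def by blast
  have "result n \<tau> = x" using \<tau>(5) x(1) by (auto simp: result_def)
  then have "?C *\<^sub>v result n \<tau> = b" using x(2) by simp
  \<comment> \<open>The coefficients of the bound from \<open>runs_gko\<close> sum to 38, and each
    monomial is at most \<open>n * n * r\<close> because \<open>n\<close> and \<open>r\<close> are
    positive.\<close>
  moreover have "ops \<tau> \<le> 40 * r * n ^ 2"
  proof -
    have le: "n \<le> n * n" "1 \<le> r" using pos by auto
    have "n \<le> n * n * r" "n * r \<le> n * n * r" "n * n \<le> n * n * r"
      using mult_le_mono[OF le] mult_le_mono1[OF le(1), of r] mult_le_mono2[OF le(2), of "n * n"]
      by auto
    moreover have "ops \<tau> \<le> n * r + (10 * (n * n * r) + 12 * (n * n)) +
      (4 * (n * n * r) + 6 * (n * n) + 2 * (n * r) + 3 * n)"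
      using \<tau>(2) init by (simp add: initial_def algebra_simps)
    ultimately have "ops \<tau> \<le> 40 * (n * n * r)" by linarith
    then show ?thesis by (simp add: power2_eq_square mult_ac)
  qed
  then have "real (ops \<tau>) \<le> real (40 * r * n ^ 2)" by (simp only: of_nat_le_iff)
  then have "real (ops \<tau>) \<le> 40 * real r * real n ^ 2" by simp
  moreover have used: "used \<tau> \<subseteq> L" using \<tau>(3) input by blast
  then have "finite (used \<tau>)" using L(1) finite_subset by blast
  \<comment> \<open>The same argument with coefficients \<open>4 + 3 + 12 = 19\<close> and the
    monomial \<open>n * r\<close>.\<close>
  moreover have "card (used \<tau>) \<le> 40 * r * n"
  proof -
    have "n \<le> n * r" "1 \<le> n * r" using pos by auto
    moreover have "card (used \<tau>) \<le> 4 * n + 3 * (n * r) + 12"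
      using card_mono[OF L(1) used] L(2) by simp
    ultimately have "card (used \<tau>) \<le> 40 * (n * r)" by linarith
    then show ?thesis by (simp add: mult_ac)
  qed
  then have "real (card (used \<tau>)) \<le> real (40 * r * n)" by (simp only: of_nat_le_iff)
  then have "real (card (used \<tau>)) \<le> 40 * real r * real n" by simp
  moreover have "real (peak \<tau>) \<le> 1 * real (n + r)"
    using \<tau>(4) init by (auto simp: initial_def)
  ultimately show "\<exists>\<tau>. exec gko_com \<sigma> \<tau> \<and> ?C *\<^sub>v result n \<tau> = b \<and>
        real (ops \<tau>) \<le> 40 * real r * real n ^ 2 \<and>
        finite (used \<tau>) \<and> real (card (used \<tau>)) \<le> 40 * real r * real n \<and>
        real (peak \<tau>) \<le> 1 * real (n + r)"
    using \<tau>(1) by blast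
qed simp

end
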